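(* Let $\{\Sigma_a\}_{a\in(0,1/2)}$ be the family of free boundary minimal annuli in $B(R(a))\subset\mathbb{S}^3$ defined in the context. Along the family, the critical points of the area $a\mapsto|\Sigma_a|$ coincide with the critical points of $R$, at which the annulus is degenerate (its Jacobi--Robin kernel contains an element not induced by any Killing field of $\mathbb{S}^3$ whose flow preserves the ball $B(R(a))$). Moreover, if $a_*\in(0,\tfrac12)$ is a maximizer of $R$, i.e. $R(a_* )=\max_{(0,1/2)}R$, then $\Sigma_{a_*}$ is a strict local maximizer of the area within the family: $a_*$ is a strict local maximum point of $a\mapsto|\Sigma_a|$.
   Context: Ambient. $\mathbb{S}^3\subset\mathbb{R}^4$ is the round unit sphere, $p_0=(1,0,0,0)$, $\rho=\operatorname{dist}(p_0,\cdot)$, $B(r)$ is the closed geodesic ball of radius $r\in(0,\pi)$ centred at $p_0$. A free boundary minimal surface in $B(r)$ is a compact two-sided minimal surface in $B(r)$ with boundary on $\partial B(r)$ whose outward unit conormal $\eta$ equals $\partial_\rho$ along the boundary. The family. For $a\in(0,\tfrac12)$ put $\lambda_a(s)=\tfrac12-a\cos 2s$, $z_a(s)=(\tfrac12+a\cos2s)^{1/2}$, $c(a)=(\tfrac14-a^2)^{1/2}$, $\omega(a,t)=\dfrac{c(a)}{z_a(t)\lambda_a(t)}$, $\beta(a,s)=\int_0^s\omega(a,t)\,dt$, $x_a=\lambda_a^{1/2}\cos\beta(a,\cdot)$, $y_a=\lambda_a^{1/2}\sin\beta(a,\cdot)$, and $X_a(s,\theta)=(x_a(s),y_a(s),z_a(s)\cos\theta,z_a(s)\sin\theta)$,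 a minimal immersion of $\mathbb{R}\times\mathbb{S}^1$ into $\mathbb{S}^3$ with induced metric $ds^2+z_a^2d\theta^2$. Let $G_a=y_a\dot z_a-z_a\dot y_a$; $s_1(a)$ is its unique zero in $(0,\tfrac\pi2]$. $\Sigma_a$ is the restriction of $X_a$ to $[-s_1(a),s_1(a)]\times\mathbb{S}^1$, an embedded free boundary minimal annulus in $B(R(a))$, with $R(a)=\arccos x_a(s_1(a))$. $R$ attains its maximum over $(0,\tfrac12)$. $|\Sigma_a|$ is the area. Kernel. The Jacobi--Robin kernel of $\Sigma_a$ is $\{u\in C^\infty(\Sigma_a):\Delta u+(|A|^2+2)u=0,\ \partial_\eta u-\cot(R(a))u=0\text{ on }\partial\Sigma_a\}$, $A$ the second fundamental form; $u$ is induced by a Killing field $Z$ if $u=\langle Z,\nu\rangle$ with $\nu$ the unit normal of $\Sigma_a$. *)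

theory Defs
  imports "HOL-Analysis.Analysis"
begin

section \<open>Smooth maps\<close>

primrec Ck_on ::
    "nat \<Rightarrow> 'a::real_normed_vector set \<Rightarrow> ('a \<Rightarrow> 'b::real_normed_vector) \<Rightarrow> bool" where
  "Ck_on 0 W f \<longleftrightarrow> continuous_on W f"
| "Ck_on (Suc k) W f \<longleftrightarrow>
     (\<forall>p\<in>W. f differentiable (at p)) \<and> (\<forall>v. Ck_on k W (\<lambda>p. frechet_derivative f (at p) v))"

text \<open>Smoothness on a set that need not be open (a closed strip, a sphere) means, as usual,
  smoothness on some open neighbourhood. Functions are total in HOL, so a function on such a set is
  represented by one of its smooth extensions; everything below depends only on the values on the
  set itself.\<close>

definition smooth_near ::
    "'a::real_normed_vector set \<Rightarrow> ('a \<Rightarrow> 'b::real_normed_vector) \<Rightarrow> bool" where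
  "smooth_near S f \<longleftrightarrow> (\<exists>W. open W \<and> S \<subseteq> W \<and> (\<forall>k. Ck_on k W f))"


section \<open>The round three-sphere\<close>

abbreviation S3 :: "(real^4) set" where
  "S3 \<equiv> sphere 0 1"

definition base_point :: "real^4" where
  "base_point = vector [1, 0, 0, 0]"

definition geodesic_ball :: "real \<Rightarrow> (real^4) set" where
  "geodesic_ball r = {q \<in> S3. arccos (base_point \<bullet> q) \<le> r}"

text \<open>The Levi-Civita connection of the sphere is the tangential part of the ambient derivative, so
  for tangent \<open>v\<close> and \<open>w\<close> the last conjunct is Killing's equation
  \<open>\<langle>\<nabla>\<^sub>v Z, w\<rangle> + \<langle>v, \<nabla>\<^sub>w Z\<rangle> = 0\<close>.\<close>

definition killing_field :: "(real^4 \<Rightarrow> real^4) \<Rightarrow> bool" where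
  "killing_field Z \<longleftrightarrow>
     smooth_near S3 Z \<and>
     (\<forall>p\<in>S3. Z p \<bullet> p = 0) \<and>
     (\<forall>p\<in>S3. \<forall>v w. v \<bullet> p = 0 \<and> w \<bullet> p = 0 \<longrightarrow>
        frechet_derivative Z (at p) v \<bullet> w + v \<bullet> frechet_derivative Z (at p) w = 0)"

definition is_flow :: "(real^4 \<Rightarrow> real^4) \<Rightarrow> (real \<Rightarrow> real^4 \<Rightarrow> real^4) \<Rightarrow> bool" where
  "is_flow Z \<Phi> \<longleftrightarrow>
     (\<forall>p\<in>S3. \<Phi> 0 p = p \<and>
        (\<forall>t. \<Phi> t p \<in> S3 \<and> ((\<lambda>\<tau>. \<Phi> \<tau> p) has_vector_derivative Z (\<Phi> t p)) (at t)))"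

definition flow_preserves :: "(real^4 \<Rightarrow> real^4) \<Rightarrow> (real^4) set \<Rightarrow> bool" where
  "flow_preserves Z B \<longleftrightarrow> (\<exists>\<Phi>. is_flow Z \<Phi> \<and> (\<forall>t. \<Phi> t ` B = B))"


section \<open>Parametrized surfaces in the three-sphere\<close>

text \<open>A surface is given by a parametrization \<open>X\<close> of (a part of) the plane into the sphere; functions
  on it are functions of the parameters.\<close>

definition d1 :: "(real \<times> real \<Rightarrow> 'a::real_normed_vector) \<Rightarrow> real \<times> real \<Rightarrow> 'a" where
  "d1 f p = vector_derivative (\<lambda>s. f (s, snd p)) (at (fst p))"

definition d2 :: "(real \<times> real \<Rightarrow> 'a::real_normed_vector) \<Rightarrow> real \<times> real \<Rightarrow> 'a" where
  "d2 f p = vector_derivative (\<lambda>\<theta>. f (fst p, \<theta>)) (at (snd p))"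

definition g11 :: "(real \<times> real \<Rightarrow> real^4) \<Rightarrow> real \<times> real \<Rightarrow> real" where
  "g11 X p = d1 X p \<bullet> d1 X p"

definition g12 :: "(real \<times> real \<Rightarrow> real^4) \<Rightarrow> real \<times> real \<Rightarrow> real" where
  "g12 X p = d1 X p \<bullet> d2 X p"

definition g22 :: "(real \<times> real \<Rightarrow> real^4) \<Rightarrow> real \<times> real \<Rightarrow> real" where
  "g22 X p = d2 X p \<bullet> d2 X p"

definition gdet :: "(real \<times> real \<Rightarrow> real^4) \<Rightarrow> real \<times> real \<Rightarrow> real" where
  "gdet X p = g11 X p * g22 X p - (g12 X p)\<^sup>2"

definition surface_area :: "(real \<times> real \<Rightarrow> real^4) \<Rightarrow> (real \<times> real) set \<Rightarrow> real" where
  "surface_area X D = integral D (\<lambda>p. sqrt (gdet X p))"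

text \<open>\<open>\<Delta>u = (det g)\<^sup>-\<^sup>1\<^sup>/\<^sup>2 \<Sum>\<^sub>i\<^sub>j \<partial>\<^sub>i ((det g)\<^sup>1\<^sup>/\<^sup>2 g\<^sup>i\<^sup>j \<partial>\<^sub>j u)\<close>, with the inverse of the
  metric written out.\<close>

definition laplace_beltrami ::
    "(real \<times> real \<Rightarrow> real^4) \<Rightarrow> (real \<times> real \<Rightarrow> real) \<Rightarrow> real \<times> real \<Rightarrow> real" where
  "laplace_beltrami X u p =
     (d1 (\<lambda>q. (g22 X q * d1 u q - g12 X q * d2 u q) / sqrt (gdet X q)) p
      + d2 (\<lambda>q. (g11 X q * d2 u q - g12 X q * d1 u q) / sqrt (gdet X q)) p)
     / sqrt (gdet X p)"

text \<open>Unit normal of the surface within the sphere, hence also orthogonal to the position vector.\<close>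

definition unit_normal ::
    "(real \<times> real \<Rightarrow> real^4) \<Rightarrow> (real \<times> real) set \<Rightarrow> (real \<times> real \<Rightarrow> real^4) \<Rightarrow> bool" where
  "unit_normal X D \<nu> \<longleftrightarrow>
     continuous_on D \<nu> \<and>
     (\<forall>p\<in>D. norm (\<nu> p) = 1 \<and> \<nu> p \<bullet> X p = 0 \<and> \<nu> p \<bullet> d1 X p = 0 \<and> \<nu> p \<bullet> d2 X p = 0)"

text \<open>The second fundamental form is \<open>h\<^sub>i\<^sub>j = \<langle>\<partial>\<^sub>i\<partial>\<^sub>j X, \<nu>\<rangle>\<close>, and \<open>|A|\<^sup>2\<close> is the trace of the square of
  the shape operator \<open>g\<^sup>-\<^sup>1 h\<close>, whose entries appear below up to the factor \<open>det g\<close>.\<close>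

definition sq_norm_A ::
    "(real \<times> real \<Rightarrow> real^4) \<Rightarrow> (real \<times> real \<Rightarrow> real^4) \<Rightarrow> real \<times> real \<Rightarrow> real" where
  "sq_norm_A X \<nu> p =
     (let h11 = d1 (d1 X) p \<bullet> \<nu> p; h12 = d1 (d2 X) p \<bullet> \<nu> p; h22 = d2 (d2 X) p \<bullet> \<nu> p;
          E = g11 X p; F = g12 X p; G = g22 X p
      in ((G * h11 - F * h12)\<^sup>2 + 2 * (G * h12 - F * h22) * (E * h12 - F * h11)
          + (E * h22 - F * h12)\<^sup>2) / (gdet X p)\<^sup>2)"

text \<open>Derivative of \<open>u\<close> in the direction of the unit conormal \<open>\<eta>\<close> to a curve of constant first
  parameter pointing towards increasing first parameter:
  \<open>\<eta> = (g\<^sub>2\<^sub>2 \<partial>\<^sub>1 - g\<^sub>1\<^sub>2 \<partial>\<^sub>2) / (g\<^sub>2\<^sub>2 det g)\<^sup>1\<^sup>/\<^sup>2\<close>.\<close>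

definition conormal_derivative ::
    "(real \<times> real \<Rightarrow> real^4) \<Rightarrow> (real \<times> real \<Rightarrow> real) \<Rightarrow> real \<times> real \<Rightarrow> real" where
  "conormal_derivative X u p =
     (g22 X p * d1 u p - g12 X p * d2 u p) / sqrt (g22 X p * gdet X p)"


section \<open>The family of free boundary minimal annuli\<close>

definition lam_prof :: "real \<Rightarrow> real \<Rightarrow> real" where
  "lam_prof a s = 1/2 - a * cos (2 * s)"

definition z_prof :: "real \<Rightarrow> real \<Rightarrow> real" where
  "z_prof a s = sqrt (1/2 + a * cos (2 * s))"

definition c_const :: "real \<Rightarrow> real" where
  "c_const a = sqrt (1/4 - a\<^sup>2)"

definition omega :: "real \<Rightarrow> real \<Rightarrow> real" where
  "omega a t = c_const a / (z_prof a t * lam_prof a t)"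

definition beta :: "real \<Rightarrow> real \<Rightarrow> real" where
  "beta a s = (LBINT t=ereal 0..ereal s. omega a t)"

definition x_prof :: "real \<Rightarrow> real \<Rightarrow> real" where
  "x_prof a s = sqrt (lam_prof a s) * cos (beta a s)"

definition y_prof :: "real \<Rightarrow> real \<Rightarrow> real" where
  "y_prof a s = sqrt (lam_prof a s) * sin (beta a s)"

definition immersion :: "real \<Rightarrow> real \<times> real \<Rightarrow> real^4" where
  "immersion a = (\<lambda>(s, \<theta>). vector
     [x_prof a s, y_prof a s, z_prof a s * cos \<theta>, z_prof a s * sin \<theta>])"

definition G_fun :: "real \<Rightarrow> real \<Rightarrow> real" where
  "G_fun a s = y_prof a s * deriv (z_prof a) s - z_prof a s * deriv (y_prof a) s"

definition s1 :: "real \<Rightarrow> real" where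
  "s1 a = (THE s. s \<in> {0<..pi/2} \<and> G_fun a s = 0)"

definition radius :: "real \<Rightarrow> real" where
  "radius a = arccos (x_prof a (s1 a))"

text \<open>The annulus is \<open>[-s\<^sub>1, s\<^sub>1] \<times> S\<^sup>1\<close>, with \<open>S\<^sup>1\<close> the line modulo \<open>2\<pi>\<close>: functions on it are functions
  on the strip that are periodic in the second variable, and its area is the area of one period
  (the immersion is injective there up to a null set).\<close>

definition strip :: "real \<Rightarrow> (real \<times> real) set" where
  "strip a = {- s1 a..s1 a} \<times> UNIV"

definition area :: "real \<Rightarrow> real" where
  "area a = surface_area (immersion a) ({- s1 a..s1 a} \<times> {0..2 * pi})"

definition periodic_on_strip :: "real \<Rightarrow> (real \<times> real \<Rightarrow> 'b) \<Rightarrow> bool" where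
  "periodic_on_strip a f \<longleftrightarrow> (\<forall>(s, \<theta>) \<in> strip a. f (s, \<theta> + 2 * pi) = f (s, \<theta>))"

definition annulus_normal :: "real \<Rightarrow> (real \<times> real \<Rightarrow> real^4) \<Rightarrow> bool" where
  "annulus_normal a \<nu> \<longleftrightarrow> unit_normal (immersion a) (strip a) \<nu> \<and> periodic_on_strip a \<nu>"

text \<open>The outward conormal at \<open>s = - s\<^sub>1\<close> points towards decreasing \<open>s\<close>, whence the sign there.\<close>

definition jacobi_robin_kernel ::
    "real \<Rightarrow> (real \<times> real \<Rightarrow> real^4) \<Rightarrow> (real \<times> real \<Rightarrow> real) set" where
  "jacobi_robin_kernel a \<nu> = {u.
     smooth_near (strip a) u \<and> periodic_on_strip a u \<and>
     (\<forall>p\<in>strip a.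
        laplace_beltrami (immersion a) u p + (sq_norm_A (immersion a) \<nu> p + 2) * u p = 0) \<and>
     (\<forall>\<theta>. conormal_derivative (immersion a) u (s1 a, \<theta>)
            - cot (radius a) * u (s1 a, \<theta>) = 0) \<and>
     (\<forall>\<theta>. - conormal_derivative (immersion a) u (- s1 a, \<theta>)
            - cot (radius a) * u (- s1 a, \<theta>) = 0)}"

definition induced_by ::
    "real \<Rightarrow> (real \<times> real \<Rightarrow> real^4) \<Rightarrow> (real \<times> real \<Rightarrow> real) \<Rightarrow> (real^4 \<Rightarrow> real^4) \<Rightarrow> bool" where
  "induced_by a \<nu> u Z \<longleftrightarrow> (\<forall>p\<in>strip a. u p = Z (immersion a p) \<bullet> \<nu> p)"

text \<open>The unit normal is determined up to a global sign, on which neither the kernel nor the set of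
  functions induced by Killing fields depends.\<close>

definition degenerate :: "real \<Rightarrow> bool" where
  "degenerate a \<longleftrightarrow>
     (\<exists>\<nu>. annulus_normal a \<nu> \<and>
        (\<exists>u \<in> jacobi_robin_kernel a \<nu>.
           \<not> (\<exists>Z. killing_field Z \<and> flow_preserves Z (geodesic_ball (radius a)) \<and>
                 induced_by a \<nu> u Z)))"

definition critical_point :: "(real \<Rightarrow> real) \<Rightarrow> real \<Rightarrow> bool" where
  "critical_point f a \<longleftrightarrow> (f has_real_derivative 0) (at a)"

definition strict_local_max :: "(real \<Rightarrow> real) \<Rightarrow> real \<Rightarrow> bool" where
  "strict_local_max f a \<longleftrightarrow> eventually (\<lambda>b. f b < f a) (at a)"

end

theory Submission
  imports Defs
begin

text \<open>
  Write \<open>C = cos 2s\<close>, \<open>S = sin 2s\<close>, \<open>K(a,s) = \<integral>\<^sub>0\<^sup>s \<partial>\<^sub>a z\<close> (\<open>area_rate\<close>) and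
  \<open>D = z\<^sup>2 - c\<^sup>2 = |1/2 + a exp(2is)|\<^sup>2\<close> (\<open>modsq\<close>). Three facts carry the proof.

  \<^bold>\<open>The end of the profile is a level curve.\<close> Up to a positive factor \<open>G\<^sub>a\<close> is minus the cosine of
  \<open>H(a,s) = \<beta>(a,s) - arctan (aS/(c z))\<close> (\<open>phase\<close>), and \<open>\<partial>\<^sub>s H = c z / D > 0\<close>. Since
  \<open>H(a,0) = 0\<close> and \<open>\<pi>/2 < H(a,\<pi>/2) < \<pi>\<close>, the parameter \<open>s\<^sub>1(a)\<close> is the only solution of
  \<open>H(a,s) = \<pi>/2\<close> and depends differentiably on \<open>a\<close>. The derivative of \<open>\<beta>\<close> in \<open>a\<close> is again
  \<open>K\<close> up to elementary terms, so that \<open>s\<^sub>1'\<close> is explicit in \<open>K\<close>. Moreover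
  \<open>R(a) = \<pi>/2 + arg (1/2 + a exp(2 i s\<^sub>1))\<close>. All this yields, at \<open>s = s\<^sub>1(a)\<close>, with
  \<open>N(a,s) = z S/2 - a (2a + C) K\<close> (\<open>balance\<close>),
  \<open>R'(a) = N / (c\<^sup>2 z)\<close> and \<open>|\<Sigma>\<^sub>a|' = 4\<pi> N / c\<^sup>2\<close>. The ratio \<open>4\<pi> z(s\<^sub>1)\<close> is the length of
  \<open>\<partial>\<Sigma>\<^sub>a\<close>, in accordance with the first variation formula. Hence both functions have the same
  critical points, the zeros of \<open>N(a, s\<^sub>1(a))\<close>.

  \<^bold>\<open>Every critical point is a strict local maximum.\<close> Dividing \<open>N\<close> by \<open>-a (2a + C)\<close> gives
  \<open>M = K - z S / (2a (2a + C))\<close> (\<open>excess\<close>), whose derivative in \<open>s\<close> is an algebraic function of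
  negative sign. For \<open>0 < s < \<pi>/2\<close> it follows that \<open>N > 0\<close> wherever \<open>2a + C \<ge> 0\<close>, so at a critical point
  \<open>2a + C < 0\<close>, and \<open>N\<close> has the sign of \<open>M\<close> nearby. There \<open>K\<close> may be eliminated from the
  derivative of \<open>M(a, s\<^sub>1(a))\<close>, which becomes \<open>\<partial>\<^sub>a K \<le> 0\<close> plus an algebraic term, negative because
  a certain polynomial in \<open>a\<close> and \<open>C\<close> is positive. Thus \<open>|\<Sigma>\<^sub>a|'\<close> changes sign from plus to minus.
  A maximizer of \<open>R\<close> is such a critical point.

  \<^bold>\<open>The variation field of the family is a Jacobi function.\<close> The multiple \<open>u = C/2 - z' K\<close> of
  \<open>\<langle>\<partial>\<^sub>a X\<^sub>a, \<nu>\<rangle>\<close> solves the Jacobi equation, and its defect in the Robin condition at \<open>s\<^sub>1\<close> is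
  \<open>- N / z\<^sup>3\<close>; so \<open>u\<close> lies in the kernel at critical points. It is constant along the parallels and
  equals \<open>1/2\<close> at \<open>s = 0\<close>. A Killing field whose flow preserves the ball is linear, skew and
  vanishes at the centre of the ball, and this forces its normal components at the points
  \<open>\<theta> = 0\<close> and \<open>\<theta> = \<pi>\<close> of a parallel to be opposite. So none of them induces \<open>u\<close>.
\<close>

section \<open>Functions of a parameter and a variable\<close>

text \<open>The mean value theorem in the second variable produces intermediate points squeezed between
  \<open>h a\<close> and \<open>h a0\<close>, and joint continuity of the partial derivative \<open>Fs\<close> makes the slopes converge.
  Both the chain rule along a graph and implicit differentiation follow from this; in the first
  variable differentiability at the single point \<open>a0\<close> suffices.\<close>

lemma secant_slope_tendsto:
  fixes F Fs :: "real \<Rightarrow> real \<Rightarrow> real"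
  assumes U: "open U" "a0 \<in> U"
    and Fs: "\<And>a s. a \<in> U \<Longrightarrow> (F a has_real_derivative Fs a s) (at s)"
    and cont: "continuous_on (U \<times> UNIV) (\<lambda>(a, s). Fs a s)"
    and h: "isCont h a0"
  obtains \<sigma> where "\<And>a. a \<in> U \<Longrightarrow> F a (h a) - F a (h a0) = \<sigma> a * (h a - h a0)"
    and "(\<sigma> \<longlongrightarrow> Fs a0 (h a0)) (at a0)"
proof -
  have "\<exists>\<xi>. \<bar>\<xi> - h a0\<bar> \<le> \<bar>h a - h a0\<bar> \<and> F a (h a) - F a (h a0) = Fs a \<xi> * (h a - h a0)"
    if "a \<in> U" for a
  proof (cases "h a" "h a0" rule: linorder_cases)
    case less
    from MVT2[OF less, of "F a" "Fs a"] Fs[OF that] obtain \<xi> where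
      "h a < \<xi>" "\<xi> < h a0" "F a (h a0) - F a (h a) = (h a0 - h a) * Fs a \<xi>" by blast
    then show ?thesis by (intro exI[of _ \<xi>]) (auto simp: algebra_simps)
  next
    case greater
    from MVT2[OF greater, of "F a" "Fs a"] Fs[OF that] obtain \<xi> where
      "h a0 < \<xi>" "\<xi> < h a" "F a (h a) - F a (h a0) = (h a - h a0) * Fs a \<xi>" by blast
    then show ?thesis by (intro exI[of _ \<xi>]) (auto simp: algebra_simps)
  qed auto
  then obtain \<xi> where
    near: "\<And>a. a \<in> U \<Longrightarrow> \<bar>\<xi> a - h a0\<bar> \<le> \<bar>h a - h a0\<bar>" and
    incr: "\<And>a. a \<in> U \<Longrightarrow> F a (h a) - F a (h a0) = Fs a (\<xi> a) * (h a - h a0)"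
    by metis
  have inU: "\<forall>\<^sub>F a in at a0. a \<in> U"
    using U eventually_at_topological by blast
  have "((\<lambda>a. \<xi> a - h a0) \<longlongrightarrow> 0) (at a0)"
  proof (rule Lim_null_comparison)
    show "\<forall>\<^sub>F a in at a0. norm (\<xi> a - h a0) \<le> \<bar>h a - h a0\<bar>"
      using inU by eventually_elim (simp add: near)
    show "((\<lambda>a. \<bar>h a - h a0\<bar>) \<longlongrightarrow> 0) (at a0)"
      using tendsto_rabs[OF LIM_zero[OF h[unfolded isCont_def]]] by simp
  qed
  then have "(\<xi> \<longlongrightarrow> h a0) (at a0)" by (rule LIM_zero_cancel)
  then have lim: "((\<lambda>a. (a, \<xi> a)) \<longlongrightarrow> (a0, h a0)) (at a0)"
    by (rule tendsto_Pair[OF tendsto_ident_at])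
  have "isCont (\<lambda>(a, s). Fs a s) (a0, h a0)"
    by (rule continuous_on_interior[OF cont]) (simp add: interior_Times interior_open U)
  from isCont_tendsto_compose[OF this lim]
  have "((\<lambda>a. Fs a (\<xi> a)) \<longlongrightarrow> Fs a0 (h a0)) (at a0)" by simp
  then show thesis using incr by (intro that[of "\<lambda>a. Fs a (\<xi> a)"])
qed

lemma has_real_derivative_along_graph:
  fixes F Fs :: "real \<Rightarrow> real \<Rightarrow> real"
  assumes U: "open U" "a0 \<in> U"
    and Fa: "((\<lambda>a. F a (h a0)) has_real_derivative Fa) (at a0)"
    and Fs: "\<And>a s. a \<in> U \<Longrightarrow> (F a has_real_derivative Fs a s) (at s)"
    and cont: "continuous_on (U \<times> UNIV) (\<lambda>(a, s). Fs a s)"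
    and h: "(h has_real_derivative h') (at a0)"
  shows "((\<lambda>a. F a (h a)) has_real_derivative Fa + Fs a0 (h a0) * h') (at a0)"
proof -
  obtain \<sigma> where incr: "\<And>a. a \<in> U \<Longrightarrow> F a (h a) - F a (h a0) = \<sigma> a * (h a - h a0)"
    and \<sigma>: "(\<sigma> \<longlongrightarrow> Fs a0 (h a0)) (at a0)"
    using secant_slope_tendsto[OF U Fs cont DERIV_isCont[OF h]] by blast
  have inU: "\<forall>\<^sub>F a in at a0. a \<in> U"
    using U eventually_at_topological by blast
  have "((\<lambda>a. (F a (h a0) - F a0 (h a0)) / (a - a0) + \<sigma> a * ((h a - h a0) / (a - a0)))
      \<longlongrightarrow> Fa + Fs a0 (h a0) * h') (at a0)"
    by (rule tendsto_add[OF Fa[unfolded has_field_derivative_iff]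
          tendsto_mult[OF \<sigma> h[unfolded has_field_derivative_iff]]])
  moreover have "\<forall>\<^sub>F a in at a0.
      (F a (h a0) - F a0 (h a0)) / (a - a0) + \<sigma> a * ((h a - h a0) / (a - a0))
      = (F a (h a) - F a0 (h a0)) / (a - a0)"
    using inU
  proof eventually_elim
    case (elim a)
    have "F a (h a) - F a0 (h a0) = (F a (h a0) - F a0 (h a0)) + \<sigma> a * (h a - h a0)"
      using incr[OF elim] by simp
    then show ?case by (simp only: add_divide_distrib times_divide_eq_right)
  qed
  ultimately show ?thesis
    unfolding has_field_derivative_iff by (rule Lim_transform_eventually)
qed

lemma has_real_derivative_implicit:
  fixes F Fs :: "real \<Rightarrow> real \<Rightarrow> real"
  assumes U: "open U" "a0 \<in> U"
    and Fa: "((\<lambda>a. F a (h a0)) has_real_derivative Fa) (at a0)"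
    and Fs: "\<And>a s. a \<in> U \<Longrightarrow> (F a has_real_derivative Fs a s) (at s)"
    and cont: "continuous_on (U \<times> UNIV) (\<lambda>(a, s). Fs a s)"
    and h: "isCont h a0" and level: "\<And>a. a \<in> U \<Longrightarrow> F a (h a) = k"
    and nz: "Fs a0 (h a0) \<noteq> 0"
  shows "(h has_real_derivative - Fa / Fs a0 (h a0)) (at a0)"
proof -
  obtain \<sigma> where incr: "\<And>a. a \<in> U \<Longrightarrow> F a (h a) - F a (h a0) = \<sigma> a * (h a - h a0)"
    and \<sigma>: "(\<sigma> \<longlongrightarrow> Fs a0 (h a0)) (at a0)"
    using secant_slope_tendsto[OF U Fs cont h] by blast
  have inU: "\<forall>\<^sub>F a in at a0. a \<in> U"
    using U eventually_at_topological by blast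
  have "((\<lambda>a. - ((F a (h a0) - F a0 (h a0)) / (a - a0)) / \<sigma> a)
      \<longlongrightarrow> - Fa / Fs a0 (h a0)) (at a0)"
    by (rule tendsto_divide[OF tendsto_minus[OF Fa[unfolded has_field_derivative_iff]] \<sigma> nz])
  moreover have "\<forall>\<^sub>F a in at a0. - ((F a (h a0) - F a0 (h a0)) / (a - a0)) / \<sigma> a
      = (h a - h a0) / (a - a0)"
    using inU tendsto_imp_eventually_ne[OF \<sigma> nz]
  proof eventually_elim
    case (elim a)
    have "F a0 (h a0) - F a (h a0) = \<sigma> a * (h a - h a0)"
      using incr[OF elim(1)] level[OF elim(1)] level[OF U(2)] by simp
    then have "h a - h a0 = - (F a (h a0) - F a0 (h a0)) / \<sigma> a"
      using elim(2) by (simp add: field_simps)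
    then show ?case by (simp add: divide_simps)
  qed
  ultimately show ?thesis
    unfolding has_field_derivative_iff by (rule Lim_transform_eventually)
qed

lemma primitive_has_real_derivative:
  fixes f :: "real \<Rightarrow> real"
  assumes "continuous_on UNIV f"
  shows "((\<lambda>s. LBINT t=ereal 0..ereal s. f t) has_real_derivative f s) (at s)"
proof -
  define m where "m = \<bar>s\<bar> + 1"
  have "((\<lambda>s. LBINT t=ereal 0..ereal s. f t) has_vector_derivative f s) (at s within {-m..m})"
    by (rule interval_integral_FTC2)
       (auto simp: m_def intro: continuous_on_subset[OF assms])
  moreover have "at s within {-m..m} = at s"
    by (rule at_within_interior) (auto simp: m_def)
  ultimately show ?thesis
    by (simp add: has_real_derivative_iff_has_vector_derivative)
qed

lemma primitive_eq_integral:
  fixes f :: "real \<Rightarrow> real"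
  assumes "continuous_on UNIV f" "0 \<le> s"
  shows "(LBINT t=ereal 0..ereal s. f t) = integral {0..s} f"
  by (rule interval_integral_eq_integral)
     (use assms in \<open>auto intro!: borel_integrable_atLeastAtMost' continuous_on_subset[OF assms(1)]\<close>)

text \<open>Differentiation under the integral sign, for the primitives that start at \<open>0\<close> and on an
  open parameter interval.\<close>

lemma primitive_deriv_parameter:
  fixes f fa :: "real \<Rightarrow> real \<Rightarrow> real"
  assumes U: "open U" "convex U" "a \<in> U" and "0 \<le> s"
    and fa: "\<And>b t. b \<in> U \<Longrightarrow> ((\<lambda>b. f b t) has_real_derivative fa b t) (at b)"
    and f: "\<And>b. b \<in> U \<Longrightarrow> continuous_on UNIV (f b)"
    and cont: "continuous_on (U \<times> UNIV) (\<lambda>(b, t). fa b t)"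
  shows "((\<lambda>b. LBINT t=ereal 0..ereal s. f b t) has_real_derivative integral {0..s} (fa a)) (at a)"
proof -
  have "((\<lambda>b. integral (cbox 0 s) (f b)) has_real_derivative integral (cbox 0 s) (fa a))
      (at a within U)"
  proof (rule leibniz_rule_field_derivative)
    show "f b integrable_on cbox 0 s" if "b \<in> U" for b
      by (rule integrable_continuous) (rule continuous_on_subset[OF f[OF that]], simp)
    show "continuous_on (U \<times> cbox 0 s) (\<lambda>(b, t). fa b t)"
      by (rule continuous_on_subset[OF cont]) auto
  qed (use U fa in \<open>auto intro: has_field_derivative_at_within\<close>)
  then have "((\<lambda>b. integral {0..s} (f b)) has_real_derivative integral {0..s} (fa a)) (at a)"
    by (simp only: at_within_open[OF U(3,1)] cbox_interval)
  then show ?thesis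
  proof (rule DERIV_cong_ev[THEN iffD1, rotated -1])
    show "\<forall>\<^sub>F b in nhds a. integral {0..s} (f b) = (LBINT t=ereal 0..ereal s. f b t)"
      using eventually_nhds_in_open[OF U(1,3)]
      by eventually_elim (simp add: primitive_eq_integral f \<open>0 \<le> s\<close>)
  qed auto
qed

section \<open>The profile curve\<close>

abbreviation params :: "real set" where
  "params \<equiv> {0<..<1/2}"

text \<open>The number \<open>|1/2 + a exp(2is)|\<^sup>2\<close>, which is the common denominator of the derivatives of
  the phase.\<close>

definition modsq :: "real \<Rightarrow> real \<Rightarrow> real" where
  "modsq a s = 1/4 + a\<^sup>2 + a * cos (2 * s)"

text \<open>The integrand is \<open>\<partial>z/\<partial>a\<close>, so this is the derivative in \<open>a\<close> of \<open>\<integral>\<^sub>0\<^sup>s z\<close>. It is the only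
  quantity in the variational formulas that is not elementary.\<close>

definition area_rate :: "real \<Rightarrow> real \<Rightarrow> real" where
  "area_rate a s = (LBINT t=ereal 0..ereal s. cos (2 * t) / (2 * z_prof a t))"

text \<open>The subtracted angle is the one for which the free boundary condition reads
  \<open>cos (phase a s) = 0\<close>; see \<open>G_fun_zero_iff\<close>.\<close>

definition phase :: "real \<Rightarrow> real \<Rightarrow> real" where
  "phase a s = beta a s - arctan (a * sin (2 * s) / (c_const a * z_prof a s))"

lemma abs_a_cos_less:
  assumes "a \<in> params"
  shows "\<bar>a * cos x\<bar> < 1/2"
proof -
  have "\<bar>a * cos x\<bar> = a * \<bar>cos x\<bar>" using assms by (simp add: abs_mult)
  also have "\<dots> \<le> a * 1" using assms by (intro mult_left_mono) auto
  finally show ?thesis using assms by simp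
qed

lemma lam_pos: "a \<in> params \<Longrightarrow> 0 < lam_prof a s"
  using abs_a_cos_less[of a "2 * s"] by (simp add: lam_prof_def)

lemma z_radicand_pos: "a \<in> params \<Longrightarrow> 0 < 1/2 + a * cos (2 * s)"
  using abs_a_cos_less[of a "2 * s"] by simp

lemma z_pos: "a \<in> params \<Longrightarrow> 0 < z_prof a s"
  using z_radicand_pos[of a s] by (simp add: z_prof_def)

lemma z_sq: "a \<in> params \<Longrightarrow> (z_prof a s)\<^sup>2 = 1/2 + a * cos (2 * s)"
  using z_radicand_pos[of a s] by (simp add: z_prof_def)

lemma c_radicand_pos:
  assumes "a \<in> params" shows "0 < 1/4 - a\<^sup>2"
proof -
  have "a\<^sup>2 < (1/2)\<^sup>2" using assms by (intro power_strict_mono) auto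
  then show ?thesis by (simp add: power2_eq_square)
qed

lemma c_pos: "a \<in> params \<Longrightarrow> 0 < c_const a"
  using c_radicand_pos[of a] by (simp add: c_const_def)

lemma c_sq: "a \<in> params \<Longrightarrow> (c_const a)\<^sup>2 = 1/4 - a\<^sup>2"
  using c_radicand_pos[of a] by (simp add: c_const_def)

lemma modsq_pos:
  assumes "a \<in> params" shows "0 < modsq a s"
proof -
  have "- a \<le> a * cos (2 * s)" using assms mult_left_mono[of "-1" "cos (2 * s)" a] by simp
  moreover have "0 < (1/2 - a)\<^sup>2" using assms by simp
  ultimately show ?thesis by (simp add: modsq_def power2_eq_square algebra_simps)
qed

lemma modsq_eq: "a \<in> params \<Longrightarrow> modsq a s = (z_prof a s)\<^sup>2 - (c_const a)\<^sup>2"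
  by (simp add: modsq_def z_sq c_sq)

lemma lam_z_sq:
  "a \<in> params \<Longrightarrow> lam_prof a s * (z_prof a s)\<^sup>2 = (c_const a)\<^sup>2 + a\<^sup>2 * (sin (2 * s))\<^sup>2"
  by (simp add: z_sq c_sq lam_prof_def sin_squared_eq) (simp add: algebra_simps power2_eq_square)

lemma lam_deriv: "(lam_prof a has_real_derivative 2 * a * sin (2 * s)) (at s)"
  unfolding lam_prof_def by (auto intro!: derivative_eq_intros)

lemma z_deriv [derivative_intros]:
  assumes "a \<in> params"
  shows "(z_prof a has_real_derivative - (a * sin (2 * s)) / z_prof a s) (at s)"
  unfolding z_prof_def using z_radicand_pos[OF assms, of s]
  by (auto intro!: derivative_eq_intros simp: divide_simps)

lemma z_deriv_param [derivative_intros]: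
  assumes "a \<in> params"
  shows "((\<lambda>a. z_prof a s) has_real_derivative cos (2 * s) / (2 * z_prof a s)) (at a)"
  unfolding z_prof_def using z_radicand_pos[OF assms, of s]
  by (auto intro!: derivative_eq_intros simp: divide_simps)

lemma c_deriv_param:
  assumes "a \<in> params"
  shows "(c_const has_real_derivative - a / c_const a) (at a)"
  unfolding c_const_def using c_radicand_pos[OF assms]
  by (auto intro!: derivative_eq_intros simp: divide_simps)

lemma continuous_profiles [continuous_intros]:
  fixes A :: "'a::t2_space set"
  assumes "continuous_on A f" "continuous_on A g"
  shows "continuous_on A (\<lambda>p. lam_prof (f p) (g p))"
    and "continuous_on A (\<lambda>p. z_prof (f p) (g p))"
    and "continuous_on A (\<lambda>p. c_const (f p))"
    and "continuous_on A (\<lambda>p. modsq (f p) (g p))"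
  unfolding lam_prof_def z_prof_def c_const_def modsq_def
  by (intro continuous_intros assms)+

lemma omega_continuous: "a \<in> params \<Longrightarrow> continuous_on A (omega a)"
  unfolding omega_def
  by (intro continuous_intros) (metis lam_pos less_irrefl mult_eq_0_iff z_pos)

lemma area_rate_integrand_continuous:
  "a \<in> params \<Longrightarrow> continuous_on A (\<lambda>t. cos (2 * t) / (2 * z_prof a t))"
  by (intro continuous_intros) (metis less_irrefl mult_eq_0_iff z_pos zero_neq_numeral)

lemma beta_deriv:
  "a \<in> params \<Longrightarrow> (beta a has_real_derivative omega a s) (at s)"
  unfolding beta_def by (rule primitive_has_real_derivative) (rule omega_continuous)

lemma area_rate_deriv:
  "a \<in> params \<Longrightarrow> (area_rate a has_real_derivative cos (2 * s) / (2 * z_prof a s)) (at s)"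
  unfolding area_rate_def
  by (rule primitive_has_real_derivative) (rule area_rate_integrand_continuous)

lemma primitive_0 [simp]: "beta a 0 = 0" "area_rate a 0 = 0"
  by (simp_all add: beta_def area_rate_def flip: zero_ereal_def)

lemma phase_0 [simp]: "phase a 0 = 0"
  by (simp add: phase_def)

text \<open>The arctangent cancels the factor \<open>\<lambda>\<close> in the denominator of \<open>\<omega>\<close>, because
  \<open>c\<^sup>2 z\<^sup>2 + a\<^sup>2 S\<^sup>2 = \<lambda> D\<close>. As in the later computations, once denominators are cleared only
  \<open>z\<^sup>2\<close>, \<open>c\<^sup>2\<close> and \<open>S\<^sup>2\<close> remain, and the relations \<open>rel\<close> turn the claim into a polynomial identity
  in \<open>a\<close> and \<open>C\<close>.\<close>

lemma phase_deriv:
  assumes "a \<in> params"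
  shows "(phase a has_real_derivative c_const a * z_prof a s / modsq a s) (at s)"
proof -
  define z c L D C S where defs: "z = z_prof a s" "c = c_const a" "L = lam_prof a s"
    "D = modsq a s" "C = cos (2 * s)" "S = sin (2 * s)"
  note pos = z_pos[OF assms, of s] c_pos[OF assms] lam_pos[OF assms, of s] modsq_pos[OF assms, of s]
  have q: "((\<lambda>s. a * sin (2 * s) / (c_const a * z_prof a s)) has_real_derivative
      (2 * a * C * (c * z) - a * S * (c * (- (a * S) / z))) / (c * z)\<^sup>2) (at s)"
    using pos assms unfolding defs
    by (auto intro!: derivative_eq_intros simp: power2_eq_square)
  have rel: "z\<^sup>2 = 1/2 + a * C" "c\<^sup>2 = 1/4 - a\<^sup>2" "L = 1/2 - a * C" "D = 1/4 + a\<^sup>2 + a * C"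
    "S\<^sup>2 = 1 - C\<^sup>2"
    using assms unfolding defs by (simp_all add: z_sq c_sq lam_prof_def modsq_def sin_squared_eq)
  have "L * D = c\<^sup>2 * z\<^sup>2 + a\<^sup>2 * S\<^sup>2"
    unfolding rel by (simp add: algebra_simps power2_eq_square)
  then have one_plus: "1 + (a * S / (c * z))\<^sup>2 = L * D / (c * z)\<^sup>2"
    using pos unfolding defs[symmetric] by (simp add: field_simps)
  have "(phase a has_real_derivative c / (z * L) -
      inverse (1 + (a * S / (c * z))\<^sup>2) *
      ((2 * a * C * (c * z) - a * S * (c * (- (a * S) / z))) / (c * z)\<^sup>2)) (at s)"
    unfolding phase_def
    by (rule DERIV_diff, use beta_deriv[OF assms, of s] in \<open>simp add: omega_def defs\<close>)
       (use DERIV_chain2[OF DERIV_arctan q] in \<open>simp add: defs\<close>)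
  also have "c / (z * L) - inverse (1 + (a * S / (c * z))\<^sup>2) *
      ((2 * a * C * (c * z) - a * S * (c * (- (a * S) / z))) / (c * z)\<^sup>2)
      = c * (D - (2 * a * C * z\<^sup>2 + a\<^sup>2 * S\<^sup>2)) / (z * L * D)"
    unfolding one_plus using pos unfolding defs[symmetric]
    by (simp add: divide_simps) (simp add: algebra_simps power2_eq_square)
  also have "D - (2 * a * C * z\<^sup>2 + a\<^sup>2 * S\<^sup>2) = L * z\<^sup>2"
    unfolding rel by (simp add: algebra_simps power2_eq_square)
  also have "c * (L * z\<^sup>2) / (z * L * D) = c * z / D"
    using pos unfolding defs[symmetric] by (simp add: power2_eq_square)
  finally show ?thesis unfolding defs .
qed

section \<open>The free boundary condition\<close>

lemma sqrt_lam_sq: "a \<in> params \<Longrightarrow> (sqrt (lam_prof a s))\<^sup>2 = lam_prof a s"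
  using lam_pos[of a s] by simp

lemma sqrt_lam_deriv:
  assumes "a \<in> params"
  shows "((\<lambda>s. sqrt (lam_prof a s)) has_real_derivative a * sin (2 * s) / sqrt (lam_prof a s)) (at s)"
  using lam_pos[OF assms, of s]
  by (auto intro!: derivative_eq_intros lam_deriv simp: divide_simps)

lemma y_deriv:
  assumes "a \<in> params"
  shows "(y_prof a has_real_derivative
    (a * sin (2 * s) * sin (beta a s) + c_const a / z_prof a s * cos (beta a s)) / sqrt (lam_prof a s)) (at s)"
  unfolding y_prof_def
  by (rule derivative_eq_intros sqrt_lam_deriv[OF assms] beta_deriv[OF assms] refl)+
     (use z_pos[OF assms, of s] lam_pos[OF assms, of s] sqrt_lam_sq[OF assms, of s] in
      \<open>simp add: omega_def divide_simps, simp add: algebra_simps power2_eq_square\<close>)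

lemma lam_plus_z_sq: "a \<in> params \<Longrightarrow> lam_prof a s + (z_prof a s)\<^sup>2 = 1"
  by (simp add: z_sq lam_prof_def)

text \<open>The terms with \<open>sin \<beta>\<close> collect the factor \<open>\<lambda> + z\<^sup>2 = 1\<close>.\<close>

lemma G_fun_eq:
  assumes "a \<in> params"
  shows "G_fun a s = - (a * sin (2 * s) * sin (beta a s) + c_const a * z_prof a s * cos (beta a s))
    / (z_prof a s * sqrt (lam_prof a s))"
proof -
  define z l S where defs: "z = z_prof a s" "l = sqrt (lam_prof a s)" "S = sin (2 * s)"
  have pos: "z > 0" "l > 0" using z_pos[OF assms] lam_pos[OF assms] by (auto simp: defs)
  have unit: "l\<^sup>2 + z\<^sup>2 = 1" using lam_plus_z_sq[OF assms, of s] sqrt_lam_sq[OF assms, of s] by (simp add: defs)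
  have "G_fun a s = l * sin (beta a s) * (- (a * S) / z)
      - z * ((a * S * sin (beta a s) + c_const a / z * cos (beta a s)) / l)"
    unfolding G_fun_def DERIV_imp_deriv[OF z_deriv[OF assms]] DERIV_imp_deriv[OF y_deriv[OF assms]]
    by (simp add: y_prof_def defs)
  also have "\<dots> = - (a * S * sin (beta a s) * (l\<^sup>2 + z\<^sup>2) + c_const a * z * cos (beta a s)) / (z * l)"
    using pos by (simp add: divide_simps) (simp add: algebra_simps power2_eq_square)
  finally show ?thesis unfolding unit by (simp add: defs)
qed

text \<open>The addition theorem: a combination of \<open>sin \<beta>\<close> and \<open>cos \<beta>\<close> is an amplitude times the cosine
  of \<open>\<beta>\<close> minus the angle of its coefficients.\<close>

lemma cos_phase:
  assumes "a \<in> params"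
  shows "a * sin (2 * s) * sin (beta a s) + c_const a * z_prof a s * cos (beta a s)
    = c_const a * z_prof a s * sqrt (1 + (a * sin (2 * s) / (c_const a * z_prof a s))\<^sup>2) * cos (phase a s)"
proof -
  define w q where defs: "w = c_const a * z_prof a s" "q = a * sin (2 * s) / w"
  have "w > 0" using assms by (simp add: defs z_pos c_pos)
  have r: "sqrt (1 + q\<^sup>2) > 0" by (simp add: add_pos_nonneg)
  have "w * sqrt (1 + q\<^sup>2) * cos (phase a s) = w * (cos (beta a s) + sin (beta a s) * q)"
    using r by (simp add: phase_def cos_diff cos_arctan sin_arctan flip: defs)
       (simp add: field_simps)
  also have "\<dots> = a * sin (2 * s) * sin (beta a s) + w * cos (beta a s)"
    using \<open>w > 0\<close> by (simp add: defs(2) field_simps)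
  finally show ?thesis by (simp add: defs)
qed

lemma G_fun_zero_iff: "a \<in> params \<Longrightarrow> G_fun a s = 0 \<longleftrightarrow> cos (phase a s) = 0"
proof -
  assume a: "a \<in> params"
  have "sqrt (1 + (a * sin (2 * s) / (c_const a * z_prof a s))\<^sup>2) > 0"
    by (simp add: add_pos_nonneg)
  then show ?thesis
    using z_pos[OF a, of s] c_pos[OF a] lam_pos[OF a, of s]
    by (simp add: G_fun_eq[OF a] cos_phase[OF a] del: mult_minus_left)
qed

lemma phase_strict_mono:
  assumes "a \<in> params" "s < t"
  shows "phase a s < phase a t"
  by (rule DERIV_pos_imp_increasing[OF assms(2)])
     (use phase_deriv z_pos c_pos modsq_pos assms(1) in \<open>blast intro: divide_pos_pos mult_pos_pos\<close>)

lemma phase_inj: "a \<in> params \<Longrightarrow> phase a s = phase a t \<longleftrightarrow> s = t"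
  using phase_strict_mono[of a s t] phase_strict_mono[of a t s] by (cases s t rule: linorder_cases) auto

lemma z_less_1: "a \<in> params \<Longrightarrow> z_prof a s < 1"
  using lam_pos[of a s] lam_plus_z_sq[of a s] z_pos[of a s] power_mono[of 1 "z_prof a s" 2] by fastforce

lemma c_less_z: "a \<in> params \<Longrightarrow> c_const a < z_prof a s"
  using modsq_pos[of a s] modsq_eq[of a s] z_pos[of a s] c_pos[of a]
  by (intro power2_less_imp_less[of "c_const a"]) auto

text \<open>A primitive of \<open>c/\<lambda>\<close>. The obvious one, \<open>arctan (k tan s)\<close>, breaks down at \<open>s = \<pi>/2\<close>; the
  present form, with the same values on \<open>[0, \<pi>/2)\<close>, is smooth for all \<open>s\<close>.\<close>

definition half_turn :: "real \<Rightarrow> real \<Rightarrow> real" where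
  "half_turn a s = (let \<mu> = (1 - 2 * c_const a) / (2 * a)
     in s + arctan (\<mu> * sin (2 * s) / (1 - \<mu> * cos (2 * s))))"

lemma half_turn_ends [simp]: "half_turn a 0 = 0" "half_turn a (pi/2) = pi/2"
  by (simp_all add: half_turn_def)

text \<open>With \<open>\<mu>\<close> the root of \<open>a (1 + \<mu>\<^sup>2) = \<mu>\<close> in \<open>(0,1)\<close>, the quotient \<open>c/\<lambda>\<close> is the Poisson kernel
  \<open>(1 - \<mu>\<^sup>2) / (1 + \<mu>\<^sup>2 - 2 \<mu> cos 2s)\<close>, whose primitive is classical.\<close>

lemma half_turn_deriv:
  assumes "a \<in> params"
  shows "(half_turn a has_real_derivative c_const a / lam_prof a s) (at s)"
proof -
  define c where "c = c_const a"
  define \<mu> where "\<mu> = (1 - 2 * c) / (2 * a)"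
  define C S where CS: "C = cos (2 * s)" "S = sin (2 * s)"
  have a: "0 < a" "a < 1/2" using assms by auto
  have c: "c > 0" "c\<^sup>2 = 1/4 - a\<^sup>2" using c_pos[OF assms] c_sq[OF assms] by (auto simp: c_def)
  have SC: "S\<^sup>2 = 1 - C\<^sup>2" by (simp add: CS sin_squared_eq)
  \<comment> \<open>This places \<open>\<mu>\<close> below \<open>1\<close>.\<close>
  have "(1 - 2 * a)\<^sup>2 < (2 * c)\<^sup>2"
  proof -
    have "(2 * c)\<^sup>2 - (1 - 2 * a)\<^sup>2 = 4 * a * (1 - 2 * a)"
      by (simp add: power_mult_distrib c) (simp add: power2_eq_square algebra_simps)
    also have "\<dots> > 0" using a by simp
    finally show ?thesis by simp
  qed
  then have "1 - 2 * a < 2 * c" using c by (intro power2_less_imp_less[of "1 - 2 * a"]) auto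
  moreover have "(2 * c)\<^sup>2 < 1\<^sup>2" using a by (simp add: power_mult_distrib c)
  then have "2 * c < 1" using c by (intro power2_less_imp_less[of "2 * c"]) auto
  ultimately have \<mu>: "0 < \<mu>" "\<mu> < 1" using a by (simp_all add: \<mu>_def)
  have den: "0 < 1 - \<mu> * C"
  proof -
    have "\<mu> * C \<le> \<mu> * 1" using \<mu> by (intro mult_left_mono) (auto simp: CS cos_le_one)
    then show ?thesis using \<mu> by linarith
  qed
  have quad: "a * (1 + \<mu>\<^sup>2) = \<mu>" and lin: "a * (1 - \<mu>\<^sup>2) = 2 * c * \<mu>"
  proof -
    have n: "4 * a\<^sup>2 + (1 - 2 * c)\<^sup>2 = 2 * (1 - 2 * c)"
      "4 * a\<^sup>2 - (1 - 2 * c)\<^sup>2 = 4 * c * (1 - 2 * c)"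
      using c(2) by (simp_all add: power2_eq_square algebra_simps)
    have "a * (1 + \<mu>\<^sup>2) = (4 * a\<^sup>2 + (1 - 2 * c)\<^sup>2) / (4 * a)"
      "a * (1 - \<mu>\<^sup>2) = (4 * a\<^sup>2 - (1 - 2 * c)\<^sup>2) / (4 * a)"
      using a by (simp_all add: \<mu>_def divide_simps power2_eq_square)
    then show "a * (1 + \<mu>\<^sup>2) = \<mu>" "a * (1 - \<mu>\<^sup>2) = 2 * c * \<mu>"
      unfolding n using a by (simp_all add: \<mu>_def field_simps)
  qed
  have L: "lam_prof a s > 0" "lam_prof a s = 1/2 - a * C"
    using lam_pos[OF assms] by (simp_all add: lam_prof_def CS)
  have "(half_turn a has_real_derivative
     1 + inverse (1 + (\<mu> * S / (1 - \<mu> * C))\<^sup>2) *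
     ((\<mu> * (2 * C)) * (1 - \<mu> * C) - (\<mu> * S) * (\<mu> * (2 * S))) / (1 - \<mu> * C)\<^sup>2) (at s)"
    unfolding half_turn_def Let_def c_def[symmetric] \<mu>_def[symmetric]
    using den unfolding CS
    by (auto intro!: derivative_eq_intros simp: power2_eq_square)
  also have "1 + inverse (1 + (\<mu> * S / (1 - \<mu> * C))\<^sup>2) *
     ((\<mu> * (2 * C)) * (1 - \<mu> * C) - (\<mu> * S) * (\<mu> * (2 * S))) / (1 - \<mu> * C)\<^sup>2
     = (1 - \<mu>\<^sup>2) / (1 + \<mu>\<^sup>2 - 2 * \<mu> * C)"
  proof -
    have sq: "(1 - \<mu> * C)\<^sup>2 + (\<mu> * S)\<^sup>2 = 1 + \<mu>\<^sup>2 - 2 * \<mu> * C"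
      by (simp add: power_mult_distrib SC) (simp add: power2_eq_square algebra_simps)
    have one: "1 + (\<mu> * S / (1 - \<mu> * C))\<^sup>2 = (1 + \<mu>\<^sup>2 - 2 * \<mu> * C) / (1 - \<mu> * C)\<^sup>2"
      using den by (simp add: sq[symmetric] power_divide add_divide_distrib)
    have pos: "1 + \<mu>\<^sup>2 - 2 * \<mu> * C > 0"
      unfolding sq[symmetric] using den by (simp add: add_pos_nonneg)
    have num: "(\<mu> * (2 * C)) * (1 - \<mu> * C) - (\<mu> * S) * (\<mu> * (2 * S)) = 2 * \<mu> * C - 2 * \<mu>\<^sup>2"
    proof -
      have "(\<mu> * S) * (\<mu> * (2 * S)) = 2 * \<mu>\<^sup>2 * S\<^sup>2" by (simp add: power2_eq_square)
      then show ?thesis unfolding SC by (simp add: power2_eq_square algebra_simps)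
    qed
    show ?thesis unfolding one num using pos den
      by (simp add: divide_simps)
  qed
  also have "\<dots> = c / lam_prof a s"
  proof -
    have "1 - \<mu>\<^sup>2 = 2 * c * \<mu> / a" "1 + \<mu>\<^sup>2 = \<mu> / a"
      using quad lin a by (simp_all add: field_simps)
    moreover have "\<mu> / a - 2 * \<mu> * C = 2 * \<mu> * lam_prof a s / a"
      unfolding L using a by (simp add: field_simps)
    ultimately have e: "1 + \<mu>\<^sup>2 - 2 * \<mu> * C = 2 * \<mu> * lam_prof a s / a"
      "1 - \<mu>\<^sup>2 = 2 * c * \<mu> / a" by simp_all
    show ?thesis unfolding e using a \<mu> L(1) by (simp add: divide_simps)
  qed
  finally show ?thesis unfolding c_def .
qed

text \<open>Both bounds come from \<open>\<integral>\<^sub>0\<^sup>\<pi>\<^sup>/\<^sup>2 c/\<lambda> = \<pi>/2\<close>. As \<open>z < 1\<close>, the integrand \<open>c/(z \<lambda>)\<close> of \<open>\<beta>\<close> exceeds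
  \<open>c/\<lambda>\<close>. As \<open>\<lambda> + z\<^sup>2 = 1\<close>, it splits as \<open>c z/\<lambda> + c/z\<close>, where the first term is less than \<open>c/\<lambda>\<close>
  and the second one less than \<open>1\<close>.\<close>

lemma beta_half_period:
  assumes "a \<in> params"
  shows "pi/2 < beta a (pi/2)" and "beta a (pi/2) < pi"
proof -
  have pos: "0 < z_prof a t" "0 < lam_prof a t" for t
    using z_pos[OF assms] lam_pos[OF assms] by auto
  note c = c_pos[OF assms]
  have omega_split: "omega a t = c_const a * z_prof a t / lam_prof a t + c_const a / z_prof a t" for t
  proof -
    have "omega a t = c_const a * (lam_prof a t + (z_prof a t)\<^sup>2) / (z_prof a t * lam_prof a t)"
      by (simp add: omega_def lam_plus_z_sq[OF assms])
    then show ?thesis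
      using pos[of t] by (simp add: divide_simps power2_eq_square algebra_simps)
  qed
  have "beta a 0 - half_turn a 0 < beta a (pi/2) - half_turn a (pi/2)"
  proof (rule DERIV_pos_imp_increasing[where f = "\<lambda>t. beta a t - half_turn a t"])
    fix t
    have "c_const a / lam_prof a t < omega a t"
      using pos[of t] c z_less_1[OF assms, of t]
      by (simp add: omega_def divide_simps)
    then have "0 < omega a t - c_const a / lam_prof a t" by simp
    with DERIV_diff[OF beta_deriv[OF assms, of t] half_turn_deriv[OF assms, of t]]
    show "\<exists>y. ((\<lambda>t. beta a t - half_turn a t) has_real_derivative y) (at t) \<and> 0 < y"
      by blast
  qed simp
  then show "pi/2 < beta a (pi/2)" by simp
  have "half_turn a 0 + 0 - beta a 0 < half_turn a (pi/2) + pi/2 - beta a (pi/2)"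
  proof (rule DERIV_pos_imp_increasing[where f = "\<lambda>t. half_turn a t + t - beta a t"])
    fix t
    have "c_const a * z_prof a t / lam_prof a t < c_const a / lam_prof a t"
      using pos[of t] c z_less_1[OF assms, of t] by (simp add: divide_strict_right_mono)
    moreover have "c_const a / z_prof a t < 1"
      using pos[of t] c c_less_z[OF assms, of t] by simp
    ultimately have "omega a t < c_const a / lam_prof a t + 1"
      by (simp add: omega_split)
    then have "0 < c_const a / lam_prof a t + 1 - omega a t" by simp
    with DERIV_diff[OF DERIV_add[OF half_turn_deriv[OF assms, of t] DERIV_ident]
        beta_deriv[OF assms, of t]]
    show "\<exists>y. ((\<lambda>t. half_turn a t + t - beta a t) has_real_derivative y) (at t) \<and> 0 < y"
      by blast
  qed simp
  then show "beta a (pi/2) < pi" by simp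
qed

lemma profiles_nonzero:
  assumes "a \<in> params"
  shows "z_prof a s \<noteq> 0" "c_const a \<noteq> 0" "lam_prof a s \<noteq> 0" "modsq a s \<noteq> 0"
  using z_pos[OF assms, of s] c_pos[OF assms] lam_pos[OF assms, of s] modsq_pos[OF assms, of s]
  by auto

lemma phase_quarter: "phase a (pi/2) = beta a (pi/2)"
  by (simp add: phase_def)

text \<open>The phase increases from \<open>0\<close> to a value in \<open>(\<pi>/2, \<pi>)\<close>, so its cosine vanishes exactly once
  on \<open>(0, \<pi>/2]\<close>.\<close>

lemma s1_characterization:
  assumes "a \<in> params"
  shows "0 < s1 a" and "s1 a < pi/2" and "phase a (s1 a) = pi/2"
proof -
  have ends: "pi/2 < phase a (pi/2)" "phase a (pi/2) < pi"
    using beta_half_period[OF assms] by (simp_all add: phase_quarter)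
  have cont: "continuous_on {0..pi/2} (phase a)"
    by (rule DERIV_continuous_on) (rule has_field_derivative_at_within[OF phase_deriv[OF assms]])
  obtain s where s: "0 \<le> s" "s \<le> pi/2" "phase a s = pi/2"
    using IVT'[of "phase a" 0 "pi/2" "pi/2"] ends cont by auto
  have "s \<noteq> 0" using s(3) by auto
  moreover have "s \<noteq> pi/2" using s(3) ends(1) by (metis less_irrefl)
  ultimately have s': "0 < s" "s < pi/2" using s by auto
  have "t = s" if t: "t \<in> {0<..pi/2}" "G_fun a t = 0" for t
  proof -
    have "0 < phase a t" using phase_strict_mono[OF assms, of 0 t] t by simp
    moreover have "phase a t \<le> phase a (pi/2)"
      using phase_strict_mono[OF assms, of t "pi/2"] t
      by (metis greaterThanAtMost_iff less_eq_real_def)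
    ultimately have range: "0 \<le> phase a t" "phase a t \<le> pi" using ends by auto
    have "cos (phase a t) = cos (pi/2)" using t G_fun_zero_iff[OF assms] by simp
    from cos_inj_pi[OF range _ _ this] have "phase a t = pi/2" by simp
    then show ?thesis
      using phase_inj[OF assms, of t s] s(3) by simp
  qed
  moreover have "s \<in> {0<..pi/2} \<and> G_fun a s = 0"
    using s s' G_fun_zero_iff[OF assms, of s] unfolding s(3) by simp
  ultimately have "s1 a = s" unfolding s1_def by (intro the_equality) auto
  then show "0 < s1 a" "s1 a < pi/2" "phase a (s1 a) = pi/2" using s s' by auto
qed

section \<open>Dependence of the free boundary on the parameter\<close>

text \<open>Differentiation under the integral sign gives \<open>\<integral>\<^sub>0\<^sup>s \<partial>\<^sub>a\<omega>\<close>. The stated closed form is a primitive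
  of \<open>\<partial>\<^sub>a\<omega>\<close> that vanishes at \<open>0\<close>, and the only integral left in it is the one of \<open>\<partial>\<^sub>a z\<close>.\<close>

lemma beta_deriv_param:
  assumes a: "a \<in> params" and s: "0 \<le> s"
  shows "((\<lambda>a. beta a s) has_real_derivative
    (area_rate a s + a * sin (2 * s) * cos (2 * s) / (2 * lam_prof a s * z_prof a s)) / c_const a) (at a)"
proof -
  define \<omega>a where "\<omega>a b t = - b / (c_const b * z_prof b t * lam_prof b t)
      - c_const b * cos (2 * t) / (2 * z_prof b t ^ 3 * lam_prof b t)
      + c_const b * cos (2 * t) / (z_prof b t * (lam_prof b t)\<^sup>2)" for b t
  define B where "B s = (area_rate a s + a * sin (2 * s) * cos (2 * s) / (2 * lam_prof a s * z_prof a s))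
      / c_const a" for s
  have "((\<lambda>b. LBINT t=ereal 0..ereal s. omega b t) has_real_derivative integral {0..s} (\<omega>a a)) (at a)"
  proof (rule primitive_deriv_parameter[where U = params])
    fix b t :: real assume b: "b \<in> params"
    note pos = z_pos[OF b, of t] c_pos[OF b] lam_pos[OF b, of t]
    have "((\<lambda>b. lam_prof b t) has_real_derivative - cos (2 * t)) (at b)"
      unfolding lam_prof_def by (auto intro!: derivative_eq_intros)
    from DERIV_divide[OF c_deriv_param[OF b] DERIV_mult[OF z_deriv_param[OF b] this]]
    show "((\<lambda>b. omega b t) has_real_derivative \<omega>a b t) (at b)"
      unfolding omega_def
      by (rule DERIV_cong) (use pos in \<open>auto simp: \<omega>a_def divide_simps\<close>,
          simp add: algebra_simps power2_eq_square power3_eq_cube)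
  next
    show "continuous_on (params \<times> UNIV) (\<lambda>(b, t). \<omega>a b t)"
      unfolding \<omega>a_def split_beta
      by (intro continuous_intros) (auto simp: profiles_nonzero)
  qed (use a s in \<open>auto intro: omega_continuous\<close>)
  moreover have "(\<omega>a a has_integral (B s - B 0)) {0..s}"
  proof (rule fundamental_theorem_of_calculus[OF s])
    fix t
    define z c L C S where defs: "z = z_prof a t" "c = c_const a" "L = lam_prof a t"
      "C = cos (2 * t)" "S = sin (2 * t)"
    have pos: "z > 0" "c > 0" "L > 0" using z_pos[OF a] c_pos[OF a] lam_pos[OF a] by (auto simp: defs)
    have rel: "z\<^sup>2 = 1/2 + a * C" "c\<^sup>2 = 1/4 - a\<^sup>2" "L = 1/2 - a * C" "S\<^sup>2 = 1 - C\<^sup>2"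
      using a unfolding defs by (simp_all add: z_sq c_sq lam_prof_def sin_squared_eq)
    have "(B has_real_derivative (C / (2 * z) +
       (((a * (2 * C)) * C + (a * S) * (- (2 * S))) * (2 * L * z) -
        (a * S * C) * (2 * (2 * a * S) * z + 2 * L * (- (a * S) / z))) / (2 * L * z)\<^sup>2) / c) (at t)"
    proof -
      have num: "((\<lambda>t. a * sin (2 * t) * cos (2 * t)) has_real_derivative
          (a * (2 * C)) * C + (a * S) * (- (2 * S))) (at t)"
        unfolding defs by (auto intro!: derivative_eq_intros)
      have den: "((\<lambda>t. 2 * lam_prof a t * z_prof a t) has_real_derivative
          2 * (2 * a * S) * z + 2 * L * (- (a * S) / z)) (at t)"
        unfolding defs using a by (auto intro!: derivative_eq_intros lam_deriv z_deriv)
      from DERIV_cdivide[OF DERIV_add[OF area_rate_deriv[OF a] DERIV_divide[OF num den]], of c]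
      show ?thesis
        using pos unfolding B_def by (simp add: defs power2_eq_square)
    qed
    also have "(C / (2 * z) +
       (((a * (2 * C)) * C + (a * S) * (- (2 * S))) * (2 * L * z) -
        (a * S * C) * (2 * (2 * a * S) * z + 2 * L * (- (a * S) / z))) / (2 * L * z)\<^sup>2) / c
       = (C * z\<^sup>2 * L\<^sup>2 + 2 * a * (C\<^sup>2 - S\<^sup>2) * L * z\<^sup>2 - a\<^sup>2 * S\<^sup>2 * C * (2 * z\<^sup>2 - L)) / (2 * c * z ^ 3 * L\<^sup>2)"
      using pos by (simp add: divide_simps) (simp add: algebra_simps power2_eq_square power3_eq_cube)
    also have "C * z\<^sup>2 * L\<^sup>2 + 2 * a * (C\<^sup>2 - S\<^sup>2) * L * z\<^sup>2 - a\<^sup>2 * S\<^sup>2 * C * (2 * z\<^sup>2 - L)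
       = - 2 * a * z\<^sup>2 * L - c\<^sup>2 * C * L + 2 * c\<^sup>2 * C * z\<^sup>2"
      unfolding rel by (simp add: algebra_simps power2_eq_square)
    also have "(- 2 * a * z\<^sup>2 * L - c\<^sup>2 * C * L + 2 * c\<^sup>2 * C * z\<^sup>2) / (2 * c * z ^ 3 * L\<^sup>2) = \<omega>a a t"
      using pos unfolding \<omega>a_def defs[symmetric]
      by (simp add: divide_simps) (simp add: algebra_simps power2_eq_square power3_eq_cube)
    finally show "(B has_vector_derivative \<omega>a a t) (at t within {0..s})"
      by (simp add: has_real_derivative_iff_has_vector_derivative has_vector_derivative_at_within)
  qed
  then have "integral {0..s} (\<omega>a a) = B s" by (auto dest: integral_unique simp: B_def)
  ultimately show ?thesis unfolding beta_def[abs_def] B_def by simp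
qed

lemma phase_deriv_param:
  assumes a: "a \<in> params" and s: "0 \<le> s"
  shows "((\<lambda>a. phase a s) has_real_derivative
    (area_rate a s - z_prof a s * sin (2 * s) / (2 * modsq a s)) / c_const a) (at a)"
proof -
  define z c L D C S K where defs: "z = z_prof a s" "c = c_const a" "L = lam_prof a s"
    "D = modsq a s" "C = cos (2 * s)" "S = sin (2 * s)" "K = area_rate a s"
  have pos: "z > 0" "c > 0" "L > 0" "D > 0"
    using z_pos[OF a] c_pos[OF a] lam_pos[OF a] modsq_pos[OF a] by (auto simp: defs)
  have rel: "z\<^sup>2 = 1/2 + a * C" "c\<^sup>2 = 1/4 - a\<^sup>2" "L = 1/2 - a * C" "D = 1/4 + a\<^sup>2 + a * C"
    "S\<^sup>2 = 1 - C\<^sup>2"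
    using a unfolding defs by (simp_all add: z_sq c_sq lam_prof_def modsq_def sin_squared_eq)
  have q: "((\<lambda>a. a * sin (2 * s) / (c_const a * z_prof a s)) has_real_derivative
      (S * (c * z) - a * S * ((- a / c) * z + c * (C / (2 * z)))) / (c * z)\<^sup>2) (at a)"
    using pos a unfolding defs
    by (auto intro!: derivative_eq_intros c_deriv_param z_deriv_param simp: power2_eq_square)
  have "L * D = c\<^sup>2 * z\<^sup>2 + a\<^sup>2 * S\<^sup>2"
    unfolding rel by (simp add: algebra_simps power2_eq_square)
  then have one_plus: "1 + (a * S / (c * z))\<^sup>2 = L * D / (c * z)\<^sup>2"
    using pos by (simp add: field_simps)
  have "((\<lambda>a. phase a s) has_real_derivative (K + a * S * C / (2 * L * z)) / c -
      inverse (1 + (a * S / (c * z))\<^sup>2) *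
      ((S * (c * z) - a * S * ((- a / c) * z + c * (C / (2 * z)))) / (c * z)\<^sup>2)) (at a)"
    unfolding phase_def
    by (rule DERIV_diff, use beta_deriv_param[OF a s] in \<open>simp add: defs\<close>)
       (use DERIV_chain2[OF DERIV_arctan q] in \<open>simp add: defs\<close>)
  also have "(K + a * S * C / (2 * L * z)) / c -
      inverse (1 + (a * S / (c * z))\<^sup>2) *
      ((S * (c * z) - a * S * ((- a / c) * z + c * (C / (2 * z)))) / (c * z)\<^sup>2)
      = (K + S * (a * C * D - 2 * z\<^sup>2 * (c\<^sup>2 + a\<^sup>2) + a * C * c\<^sup>2) / (2 * L * D * z)) / c"
    unfolding one_plus using pos
    by (simp add: divide_simps) (simp add: algebra_simps power2_eq_square)
  also have "a * C * D - 2 * z\<^sup>2 * (c\<^sup>2 + a\<^sup>2) + a * C * c\<^sup>2 = - (z\<^sup>2 * L)"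
    unfolding rel by (simp add: algebra_simps power2_eq_square)
  also have "S * - (z\<^sup>2 * L) / (2 * L * D * z) = - (z * S / (2 * D))"
    using pos by (simp add: divide_simps power2_eq_square)
  finally show ?thesis by (simp add: defs)
qed

text \<open>A strictly increasing function that depends continuously on \<open>a\<close> crosses a fixed level at a
  point that depends continuously on \<open>a\<close>.\<close>

lemma s1_isCont:
  assumes a: "a \<in> params"
  shows "isCont s1 a"
proof -
  have inU: "\<forall>\<^sub>F b in at a. b \<in> params"
    using a by (intro eventually_at_in_open') auto
  have lim: "((\<lambda>b. phase b s) \<longlongrightarrow> phase a s) (at a)" if "0 \<le> s" for s
    using DERIV_isCont[OF phase_deriv_param[OF a that]] by (simp add: isCont_def)
  note s1 = s1_characterization
  have "(s1 \<longlongrightarrow> s1 a) (at a)"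
  proof (rule order_tendstoI)
    fix u assume u: "u < s1 a"
    show "\<forall>\<^sub>F b in at a. u < s1 b"
    proof (cases "0 \<le> u")
      case True
      have "phase a u < pi/2" using phase_strict_mono[OF a u] s1[OF a] by simp
      from order_tendstoD(2)[OF lim[OF True] this] inU show ?thesis
      proof eventually_elim
        case (elim b)
        show ?case
        proof (rule ccontr)
          assume "\<not> u < s1 b"
          then have "phase b (s1 b) \<le> phase b u"
            using phase_strict_mono[OF elim(2), of "s1 b" u] by (cases "s1 b = u") auto
          then show False using elim s1(3)[OF elim(2)] by simp
        qed
      qed
    next
      case False
      show ?thesis using inU by eventually_elim (use False s1(1) in force)
    qed
  next
    fix u assume u: "s1 a < u"
    then have "0 \<le> u" using s1(1)[OF a] by simp
    have "pi/2 < phase a u" using phase_strict_mono[OF a u] s1[OF a] by simp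
    from order_tendstoD(1)[OF lim[OF \<open>0 \<le> u\<close>] this] inU show "\<forall>\<^sub>F b in at a. s1 b < u"
    proof eventually_elim
      case (elim b)
      show ?case
      proof (rule ccontr)
        assume "\<not> s1 b < u"
        then have "phase b u \<le> phase b (s1 b)"
          using phase_strict_mono[OF elim(2), of u "s1 b"] by (cases "s1 b = u") auto
        then show False using elim s1(3)[OF elim(2)] by simp
      qed
    qed
  qed
  then show ?thesis by (simp add: isCont_def)
qed

lemma s1_deriv:
  assumes a: "a \<in> params"
  shows "(s1 has_real_derivative
    - (modsq a (s1 a) * area_rate a (s1 a) - z_prof a (s1 a) * sin (2 * s1 a) / 2)
      / ((c_const a)\<^sup>2 * z_prof a (s1 a))) (at a)"
proof -
  have "(s1 has_real_derivative
    - ((area_rate a (s1 a) - z_prof a (s1 a) * sin (2 * s1 a) / (2 * modsq a (s1 a))) / c_const a)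
      / (c_const a * z_prof a (s1 a) / modsq a (s1 a))) (at a)"
  proof (rule has_real_derivative_implicit[where U = params and F = phase and h = s1 and k = "pi/2"
        and Fs = "\<lambda>a s. c_const a * z_prof a s / modsq a s"])
    show "((\<lambda>a'. phase a' (s1 a)) has_real_derivative
      (area_rate a (s1 a) - z_prof a (s1 a) * sin (2 * s1 a) / (2 * modsq a (s1 a))) / c_const a) (at a)"
      using phase_deriv_param[OF a less_imp_le[OF s1_characterization(1)[OF a]]] .
    show "continuous_on (params \<times> UNIV) (\<lambda>(a, s). c_const a * z_prof a s / modsq a s)"
      unfolding split_beta by (intro continuous_intros) (auto simp: profiles_nonzero)
    show "c_const a * z_prof a (s1 a) / modsq a (s1 a) \<noteq> 0"
      using z_pos[OF a, of "s1 a"] c_pos[OF a] modsq_pos[OF a, of "s1 a"] by simp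
  qed (use a in \<open>simp_all add: phase_deriv s1_isCont s1_characterization del: greaterThanLessThan_iff\<close>)
  then show ?thesis
    by (rule DERIV_cong)
       (use z_pos[OF a, of "s1 a"] c_pos[OF a] modsq_pos[OF a, of "s1 a"] in
        \<open>simp add: divide_simps power2_eq_square\<close>)
qed

section \<open>First variation of area and radius\<close>

definition half_area :: "real \<Rightarrow> real \<Rightarrow> real" where
  "half_area a s = (LBINT t=ereal 0..ereal s. z_prof a t)"

text \<open>The common numerator of the derivatives of radius and area along the family, when evaluated at
  \<open>s = s\<^sub>1(a)\<close>; it is also the obstruction to the Robin condition for the variation field.\<close>

definition balance :: "real \<Rightarrow> real \<Rightarrow> real" where
  "balance a s = z_prof a s * sin (2 * s) / 2 - a * (2 * a + cos (2 * s)) * area_rate a s"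

lemma z_continuous: "continuous_on A (z_prof a)"
  by (intro continuous_intros)

lemma half_area_deriv: "(half_area a has_real_derivative z_prof a s) (at s)"
  unfolding half_area_def by (rule primitive_has_real_derivative) (rule z_continuous)

lemma half_area_deriv_param:
  assumes a: "a \<in> params" and s: "0 \<le> s"
  shows "((\<lambda>a. half_area a s) has_real_derivative area_rate a s) (at a)"
proof -
  have "((\<lambda>b. LBINT t=ereal 0..ereal s. z_prof b t) has_real_derivative
      integral {0..s} (\<lambda>t. cos (2 * t) / (2 * z_prof a t))) (at a)"
  proof (rule primitive_deriv_parameter[where U = params])
    show "continuous_on (params \<times> UNIV) (\<lambda>(b, t). cos (2 * t) / (2 * z_prof b t))"
      unfolding split_beta by (intro continuous_intros) (auto simp: profiles_nonzero)
  qed (use a s in \<open>auto intro: z_continuous z_deriv_param\<close>)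
  then show ?thesis
    unfolding half_area_def area_rate_def
    by (simp add: primitive_eq_integral[OF area_rate_integrand_continuous[OF a] s])
qed

text \<open>Only the sign of the derivative matters: \<open>\<partial>\<^sub>a (C/(2z)) = - C\<^sup>2/(4z\<^sup>3)\<close>.\<close>

lemma area_rate_deriv_param:
  assumes a: "a \<in> params" and s: "0 \<le> s"
  obtains r where "r \<le> 0" "((\<lambda>a. area_rate a s) has_real_derivative r) (at a)"
proof -
  define g where "g b t = - (cos (2 * t))\<^sup>2 / (4 * z_prof b t ^ 3)" for b t
  have der: "((\<lambda>b. LBINT t=ereal 0..ereal s. cos (2 * t) / (2 * z_prof b t)) has_real_derivative
      integral {0..s} (g a)) (at a)"
  proof (rule primitive_deriv_parameter[where U = params])
    fix b t :: real assume b: "b \<in> params"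
    show "((\<lambda>b. cos (2 * t) / (2 * z_prof b t)) has_real_derivative g b t) (at b)"
      unfolding g_def using z_pos[OF b, of t] b
      by (auto intro!: derivative_eq_intros z_deriv_param
            simp: divide_simps power2_eq_square power3_eq_cube)
  next
    show "continuous_on (params \<times> UNIV) (\<lambda>(b, t). g b t)"
      unfolding g_def split_beta by (intro continuous_intros) (auto simp: profiles_nonzero)
  qed (use a s in \<open>auto intro: area_rate_integrand_continuous\<close>)
  have le: "integral {0..s} (g a) \<le> integral {0..s} (\<lambda>_. 0)"
  proof (rule integral_le)
    show "g a integrable_on {0..s}"
      unfolding g_def using a
      by (intro integrable_continuous_interval continuous_intros) (auto simp: profiles_nonzero)
    show "g a t \<le> 0" for t
      using z_pos[OF a, of t] by (simp add: g_def)
  qed (rule integrable_0)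
  then have "integral {0..s} (g a) \<le> 0" by simp
  with der show thesis using that unfolding area_rate_def by blast
qed

lemma half_area_s1_deriv:
  assumes a: "a \<in> params"
  shows "((\<lambda>a. half_area a (s1 a)) has_real_derivative balance a (s1 a) / (c_const a)\<^sup>2) (at a)"
proof -
  have "((\<lambda>a. half_area a (s1 a)) has_real_derivative area_rate a (s1 a) + z_prof a (s1 a) *
    (- (modsq a (s1 a) * area_rate a (s1 a) - z_prof a (s1 a) * sin (2 * s1 a) / 2)
      / ((c_const a)\<^sup>2 * z_prof a (s1 a)))) (at a)"
  proof (rule has_real_derivative_along_graph[where U = params and F = half_area and Fs = z_prof])
    show "continuous_on (params \<times> UNIV) (\<lambda>(a, s). z_prof a s)"
      unfolding split_beta by (intro continuous_intros)
  qed (use a s1_characterization(1)[OF a] s1_deriv[OF a] in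
      \<open>simp_all add: half_area_deriv half_area_deriv_param del: minus_diff_eq\<close>)
  moreover have "modsq a (s1 a) = (c_const a)\<^sup>2 + a * (2 * a + cos (2 * s1 a))"
    by (simp add: modsq_def c_sq[OF a]) (simp add: algebra_simps power2_eq_square)
  ultimately show ?thesis
    using z_pos[OF a, of "s1 a"] c_pos[OF a]
    by (elim DERIV_cong) (simp add: balance_def divide_simps, simp add: algebra_simps)
qed

text \<open>At \<open>s\<^sub>1\<close> the angle \<open>\<beta>\<close> equals \<open>\<pi>/2 + arctan (aS/(c z))\<close>, so \<open>x\<^sub>a(s\<^sub>1) = - a S / \<surd>D\<close> is minus the
  sine of the argument of \<open>1/2 + a exp(2 i s\<^sub>1)\<close>, a number with real part \<open>z\<^sup>2\<close>, imaginary part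
  \<open>a S\<close> and modulus \<open>\<surd>D\<close>.\<close>

lemma radius_eq:
  assumes a: "a \<in> params"
  shows "radius a = pi/2 + arctan (a * sin (2 * s1 a) / (z_prof a (s1 a))\<^sup>2)"
proof -
  define z c L D C S where defs: "z = z_prof a (s1 a)" "c = c_const a" "L = lam_prof a (s1 a)"
    "D = modsq a (s1 a)" "C = cos (2 * s1 a)" "S = sin (2 * s1 a)"
  define q t where "q = a * S / (c * z)" and "t = a * S / z\<^sup>2"
  have pos: "z > 0" "c > 0" "L > 0" "D > 0"
    using z_pos[OF a] c_pos[OF a] lam_pos[OF a] modsq_pos[OF a] by (auto simp: defs)
  have rel: "z\<^sup>2 = 1/2 + a * C" "c\<^sup>2 = 1/4 - a\<^sup>2" "L = 1/2 - a * C" "D = 1/4 + a\<^sup>2 + a * C"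
    "S\<^sup>2 = 1 - C\<^sup>2"
    using a unfolding defs by (simp_all add: z_sq c_sq lam_prof_def modsq_def sin_squared_eq)
  have "L * D = c\<^sup>2 * z\<^sup>2 + a\<^sup>2 * S\<^sup>2"
    unfolding rel by (simp add: algebra_simps power2_eq_square)
  then have q: "1 + q\<^sup>2 = L * D / (c * z)\<^sup>2"
    using pos by (simp add: q_def field_simps)
  have "D = (z\<^sup>2)\<^sup>2 + a\<^sup>2 * S\<^sup>2"
    unfolding rel by (simp add: algebra_simps power2_eq_square)
  then have t: "1 + t\<^sup>2 = D / (z\<^sup>2)\<^sup>2"
    using pos by (simp add: t_def field_simps)
  have "beta a (s1 a) = pi/2 + arctan q"
    using s1_characterization(3)[OF a] by (simp add: phase_def q_def defs)
  then have "x_prof a (s1 a) = - (sqrt L * (q / sqrt (1 + q\<^sup>2)))"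
    by (simp add: x_prof_def defs cos_add sin_arctan)
  also have "\<dots> = - (t / sqrt (1 + t\<^sup>2))"
  proof -
    have "sqrt (1 + q\<^sup>2) = sqrt L * sqrt D / (c * z)"
      unfolding q using pos by (simp add: real_sqrt_divide real_sqrt_mult)
    moreover have "sqrt (1 + t\<^sup>2) = sqrt D / z\<^sup>2"
      unfolding t by (simp only: real_sqrt_divide real_sqrt_abs abs_power2)
    ultimately show ?thesis using pos by (simp add: q_def t_def)
  qed
  also have "\<dots> = cos (pi/2 + arctan t)"
    by (simp add: cos_add sin_arctan)
  finally have "radius a = arccos (cos (pi/2 + arctan t))" by (simp add: radius_def)
  also have "\<dots> = pi/2 + arctan t"
    using arctan_bounded[of t] by (intro arccos_cos) auto
  finally show ?thesis by (simp add: t_def defs)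
qed

lemma radius_deriv:
  assumes a: "a \<in> params"
  shows "(radius has_real_derivative
    balance a (s1 a) / ((c_const a)\<^sup>2 * z_prof a (s1 a))) (at a)"
proof -
  define z c D C S K s' where defs: "z = z_prof a (s1 a)" "c = c_const a"
    "D = modsq a (s1 a)" "C = cos (2 * s1 a)" "S = sin (2 * s1 a)" "K = area_rate a (s1 a)"
    "s' = - (D * K - z * S / 2) / (c\<^sup>2 * z)"
  have pos: "z > 0" "c > 0" "D > 0"
    using z_pos[OF a] c_pos[OF a] modsq_pos[OF a] by (auto simp: defs)
  have rel: "z\<^sup>2 = 1/2 + a * C" "c\<^sup>2 = 1/4 - a\<^sup>2" "D = 1/4 + a\<^sup>2 + a * C"
    "S\<^sup>2 = 1 - C\<^sup>2"
    using a unfolding defs(1-6) by (simp_all add: z_sq c_sq modsq_def sin_squared_eq)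
  define v where "v = 1/2 + a * C"
  have v: "v > 0" using pos rel(1) by (simp add: v_def flip: rel(1))
  have s': "(s1 has_real_derivative s') (at a)"
    using s1_deriv[OF a] by (simp add: defs)
  have num: "((\<lambda>a. a * sin (2 * s1 a)) has_real_derivative S + 2 * a * C * s') (at a)"
    unfolding defs(4,5) by (auto intro!: derivative_eq_intros s')
  have den: "((\<lambda>a. 1/2 + a * cos (2 * s1 a)) has_real_derivative C - 2 * a * S * s') (at a)"
    unfolding defs(4,5) by (auto intro!: derivative_eq_intros s')
  have quot: "((\<lambda>a. a * sin (2 * s1 a) / (1/2 + a * cos (2 * s1 a))) has_real_derivative
      ((S + 2 * a * C * s') * v - a * S * (C - 2 * a * S * s')) / v\<^sup>2) (at a)"
    using DERIV_divide[OF num den] v by (simp add: v_def defs(4,5) power2_eq_square)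
  have "((\<lambda>a. pi/2 + arctan (a * sin (2 * s1 a) / (1/2 + a * cos (2 * s1 a)))) has_real_derivative
      0 + inverse (1 + (a * S / v)\<^sup>2) *
        (((S + 2 * a * C * s') * v - a * S * (C - 2 * a * S * s')) / v\<^sup>2)) (at a)"
    by (rule DERIV_add[OF DERIV_const])
       (use DERIV_chain2[OF DERIV_arctan quot] in \<open>simp add: v_def defs(4,5)\<close>)
  also have "0 + inverse (1 + (a * S / v)\<^sup>2) *
        (((S + 2 * a * C * s') * v - a * S * (C - 2 * a * S * s')) / v\<^sup>2)
      = (S / 2 + a * (2 * a + C) * s') / D"
  proof -
    have D: "D = v\<^sup>2 + (a * S)\<^sup>2"
      by (simp add: power_mult_distrib rel(3,4) v_def) (simp add: algebra_simps power2_eq_square)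
    have "1 + (a * S / v)\<^sup>2 = D / v\<^sup>2"
      using v by (simp add: D field_simps)
    moreover have "(S + 2 * a * C * s') * v - a * S * (C - 2 * a * S * s')
        = S * (v - a * C) + 2 * a * s' * (C * v + a * S\<^sup>2)"
      by (simp add: algebra_simps power2_eq_square)
    moreover have "\<dots> = S / 2 + a * (2 * a + C) * s'"
      unfolding rel(4) by (simp add: v_def algebra_simps power2_eq_square)
    ultimately show ?thesis using v pos by simp
  qed
  also have "\<dots> = (z * S / 2 - a * (2 * a + C) * K) / (c\<^sup>2 * z)"
  proof -
    have Dc: "D = c\<^sup>2 + a * (2 * a + C)"
      unfolding rel by (simp add: algebra_simps power2_eq_square)
    have "S / 2 + a * (2 * a + C) * s'
       = (S * c\<^sup>2 * z / 2 - (D - c\<^sup>2) * (D * K - z * S / 2)) / (c\<^sup>2 * z)"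
      using pos by (simp add: Dc defs(7) divide_simps)
    also have "\<dots> = D * (z * S / 2 - a * (2 * a + C) * K) / (c\<^sup>2 * z)"
      by (simp add: Dc) (simp add: algebra_simps)
    finally show ?thesis using pos by simp
  qed
  finally have "((\<lambda>a. pi/2 + arctan (a * sin (2 * s1 a) / (1/2 + a * cos (2 * s1 a))))
    has_real_derivative balance a (s1 a) / ((c_const a)\<^sup>2 * z_prof a (s1 a))) (at a)"
    by (simp add: balance_def defs)
  then show ?thesis
    by (rule has_field_derivative_transform_within_open[where S = params])
       (use a in \<open>simp_all add: radius_eq z_sq del: greaterThanLessThan_iff\<close>)
qed

section \<open>Sign change of the first variation\<close>

text \<open>With \<open>e = 2a\<close> the value at \<open>C = -1\<close> is \<open>(1 - e)\<^sup>2 (2 + e)\<close>, and the difference to that value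
  is \<open>1 + C\<close> times a nonnegative factor.\<close>

lemma excess_slope_numerator_pos:
  fixes a C :: real
  assumes "a \<in> params" "\<bar>C\<bar> \<le> 1"
  shows "0 < 2 + 6 * a * C - 4 * a\<^sup>2 * (1 - C\<^sup>2) - 8 * a ^ 3 * C"
proof -
  define e where "e = 2 * a"
  have e: "0 < e" "e < 1" using assms by (auto simp: e_def)
  have "2 + 6 * a * C - 4 * a\<^sup>2 * (1 - C\<^sup>2) - 8 * a ^ 3 * C
    = (1 - e)\<^sup>2 * (2 + e) + (1 + C) * (e * (3 + e) * (1 - e) + e\<^sup>2 * (1 + C))"
    by (simp add: e_def power2_eq_square power3_eq_cube algebra_simps)
  moreover have "0 < (1 - e)\<^sup>2 * (2 + e)" using e by simp
  moreover have "0 \<le> (1 + C) * (e * (3 + e) * (1 - e) + e\<^sup>2 * (1 + C))"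
  proof (intro mult_nonneg_nonneg)
    show C: "0 \<le> 1 + C" using assms(2) by linarith
    show "0 \<le> e * (3 + e) * (1 - e) + e\<^sup>2 * (1 + C)"
      using e C by (intro add_nonneg_nonneg[of "e * (3 + e) * (1 - e)"] mult_nonneg_nonneg) auto
  qed
  ultimately show ?thesis by linarith
qed

text \<open>Dividing \<open>balance\<close> by the coefficient of \<open>area_rate\<close> leaves a function whose derivative in
  \<open>s\<close> is algebraic.\<close>

definition excess :: "real \<Rightarrow> real \<Rightarrow> real" where
  "excess a s = area_rate a s - z_prof a s * sin (2 * s) / (2 * a * (2 * a + cos (2 * s)))"

lemma balance_eq_excess:
  assumes "a \<in> params" "2 * a + cos (2 * s) \<noteq> 0"
  shows "balance a s = - (a * (2 * a + cos (2 * s))) * excess a s"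
proof -
  define u where "u = 2 * a + cos (2 * s)"
  have "a \<noteq> 0" "u \<noteq> 0" using assms by (auto simp: u_def)
  then show ?thesis
    unfolding balance_def excess_def u_def[symmetric] by (simp add: divide_simps)
qed

lemma excess_deriv_neg:
  assumes a: "a \<in> params" and u: "2 * a + cos (2 * s) \<noteq> 0"
  shows "\<exists>r. (excess a has_real_derivative r) (at s) \<and> r < 0"
proof -
  define z C S u where defs: "z = z_prof a s" "C = cos (2 * s)" "S = sin (2 * s)" "u = 2 * a + C"
  have pos: "z > 0" "0 < a" "u \<noteq> 0" using z_pos[OF a] a assms(2) by (auto simp: defs)
  have rel: "z\<^sup>2 = 1/2 + a * C" "S\<^sup>2 = 1 - C\<^sup>2"
    using a unfolding defs(1-3) by (simp_all add: z_sq sin_squared_eq)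
  have num: "((\<lambda>s. z_prof a s * sin (2 * s)) has_real_derivative
      - (a * S) / z * S + z * (2 * C)) (at s)"
    unfolding defs using a by (auto intro!: derivative_eq_intros z_deriv)
  have den: "((\<lambda>s. 2 * a * (2 * a + cos (2 * s))) has_real_derivative 2 * a * (- (2 * S))) (at s)"
    unfolding defs by (auto intro!: derivative_eq_intros)
  have nz: "2 * a * (2 * a + cos (2 * s)) \<noteq> 0" using pos by (simp add: defs)
  have "(excess a has_real_derivative C / (2 * z)
     - ((- (a * S) / z * S + z * (2 * C)) * (2 * a * u) - z * S * (2 * a * (- (2 * S)))) / (2 * a * u)\<^sup>2) (at s)"
    unfolding excess_def
    using DERIV_diff[OF area_rate_deriv[OF a, of s] DERIV_divide[OF num den nz]]
    by (simp add: defs power2_eq_square)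
  also have "C / (2 * z)
     - ((- (a * S) / z * S + z * (2 * C)) * (2 * a * u) - z * S * (2 * a * (- (2 * S)))) / (2 * a * u)\<^sup>2
    = - (- 2 * a * C * u\<^sup>2 - 2 * a * S\<^sup>2 * u + 4 * z\<^sup>2 * C * u + 4 * z\<^sup>2 * S\<^sup>2) / (4 * a * u\<^sup>2 * z)"
    using pos by (simp add: divide_simps) (simp add: algebra_simps power2_eq_square)
  also have "- 2 * a * C * u\<^sup>2 - 2 * a * S\<^sup>2 * u + 4 * z\<^sup>2 * C * u + 4 * z\<^sup>2 * S\<^sup>2
    = 2 + 6 * a * C - 4 * a\<^sup>2 * (1 - C\<^sup>2) - 8 * a ^ 3 * C"
    unfolding rel defs(4) by (simp add: algebra_simps power2_eq_square power3_eq_cube)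
  finally have d: "(excess a has_real_derivative - (2 + 6 * a * C - 4 * a\<^sup>2 * (1 - C\<^sup>2) - 8 * a ^ 3 * C)
      / (4 * a * u\<^sup>2 * z)) (at s)" .
  have "- (2 + 6 * a * C - 4 * a\<^sup>2 * (1 - C\<^sup>2) - 8 * a ^ 3 * C) / (4 * a * u\<^sup>2 * z) < 0"
    using excess_slope_numerator_pos[OF a, of C] pos by (intro divide_neg_pos) (auto simp: defs(2))
  with d show ?thesis by blast
qed

text \<open>On \<open>[0, s]\<close> the denominator \<open>2a + cos 2t\<close> of the excess stays positive, so the excess decreases
  there from its value \<open>0\<close> at the origin.\<close>

lemma balance_pos:
  assumes a: "a \<in> params" and s: "0 < s" "s < pi/2" and u: "0 \<le> 2 * a + cos (2 * s)"
  shows "0 < balance a s"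
proof (cases "2 * a + cos (2 * s) = 0")
  case True
  have "0 < sin (2 * s)" using s by (intro sin_gt_zero) auto
  then show ?thesis unfolding balance_def True using z_pos[OF a] by simp
next
  case False
  have "excess a s < excess a 0"
  proof (rule DERIV_neg_imp_decreasing[OF s(1)])
    fix t assume t: "0 \<le> t" "t \<le> s"
    have "cos (2 * s) \<le> cos (2 * t)" using s t by (intro cos_monotone_0_pi_le) auto
    then have "2 * a + cos (2 * t) \<noteq> 0" using u False by linarith
    from excess_deriv_neg[OF a this]
    show "\<exists>y. (excess a has_real_derivative y) (at t) \<and> y < 0" .
  qed
  then have "excess a s < 0" by (simp add: excess_def)
  moreover have "0 < a * (2 * a + cos (2 * s))" using a u False by simp
  ultimately show ?thesis
    unfolding balance_eq_excess[OF a False] by (simp add: mult_pos_neg)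
qed

text \<open>The numbers \<open>e\<close>, \<open>x = - C - e\<close> and \<open>y = 1 + C\<close> are barycentric coordinates on the triangle in
  question: they are nonnegative and add up to \<open>1\<close>. Made homogeneous of degree four in them, the
  polynomial has nonnegative coefficients only.\<close>

lemma crossing_polynomial_pos:
  fixes e C :: real
  assumes "0 < e" "e < 1" "- 1 \<le> C" "C \<le> - e"
  shows "0 < 2 + 3 * e\<^sup>2 + 9 * e * C + 2 * e ^ 3 * C + 5 * e\<^sup>2 * C\<^sup>2 + 2 * C\<^sup>2 + e * C ^ 3"
proof -
  define x y where "x = - C - e" and "y = 1 + C"
  have nn: "0 \<le> x" "0 \<le> y" "0 < e" using assms by (auto simp: x_def y_def)
  have xy: "0 < x + y" using assms by (simp add: x_def y_def)
  have e: "e = 1 - x - y" and C: "C = y - 1" by (simp_all add: x_def y_def)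
  have "2 + 3 * e\<^sup>2 + 9 * e * C + 2 * e ^ 3 * C + 5 * e\<^sup>2 * C\<^sup>2 + 2 * C\<^sup>2 + e * C ^ 3
    = 4 * x ^ 4 + 12 * x ^ 3 * y + 14 * x\<^sup>2 * y\<^sup>2 + 8 * x * y ^ 3 + 2 * y ^ 4
      + e * (6 * x ^ 3 + 18 * x\<^sup>2 * y + 19 * x * y\<^sup>2 + 8 * y ^ 3)
      + e\<^sup>2 * (2 * x\<^sup>2 + 6 * x * y + 8 * y\<^sup>2)"
    unfolding C e by (simp add: algebra_simps power2_eq_square power3_eq_cube power4_eq_xxxx)
  also have "\<dots> > 0"
  proof -
    have "0 < 4 * x ^ 4 + 2 * y ^ 4"
      using xy nn by (cases "x = 0") (auto intro!: add_pos_nonneg)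
    moreover have "0 \<le> 12 * x ^ 3 * y" "0 \<le> 14 * x\<^sup>2 * y\<^sup>2" "0 \<le> 8 * x * y ^ 3"
      "0 \<le> e * (6 * x ^ 3 + 18 * x\<^sup>2 * y + 19 * x * y\<^sup>2 + 8 * y ^ 3)"
      "0 \<le> e\<^sup>2 * (2 * x\<^sup>2 + 6 * x * y + 8 * y\<^sup>2)"
      using nn by (auto intro!: mult_nonneg_nonneg add_nonneg_nonneg)
    ultimately show ?thesis by linarith
  qed
  finally show ?thesis .
qed

text \<open>At a critical point \<open>K = z S/(2a (2a + C))\<close> and the formula for \<open>s\<^sub>1'\<close> collapses to \<open>- K/z\<close>.
  Inserting both, the derivative of the excess along the curve \<open>s = s\<^sub>1(a)\<close> becomes \<open>\<partial>\<^sub>a K \<le> 0\<close>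
  plus an algebraic term that is a negative multiple of the polynomial of
  \<open>crossing_polynomial_pos\<close>, taken at \<open>e = 2a\<close>.\<close>

lemma excess_s1_deriv_neg:
  assumes a: "a \<in> params" and crit: "balance a (s1 a) = 0"
  shows "2 * a + cos (2 * s1 a) < 0"
    and "\<exists>r. ((\<lambda>a. excess a (s1 a)) has_real_derivative r) (at a) \<and> r < 0"
proof -
  note s1 = s1_characterization[OF a]
  show neg: "2 * a + cos (2 * s1 a) < 0"
    using balance_pos[OF a s1(1,2)] crit by linarith
  define z c C S K u w where defs: "z = z_prof a (s1 a)" "c = c_const a"
    "C = cos (2 * s1 a)" "S = sin (2 * s1 a)" "K = area_rate a (s1 a)" "u = 2 * a + C" "w = 2 * a * u"
  define s' where "s' = - S / w"
  have pos: "z > 0" "c > 0" "0 < a" "a < 1/2" "u < 0"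
    using z_pos[OF a] c_pos[OF a] a neg by (auto simp: defs)
  then have w: "w < 0" by (simp add: defs(7) mult_pos_neg)
  have S: "S > 0" using s1 unfolding defs by (intro sin_gt_zero) auto
  have rel: "z\<^sup>2 = 1/2 + a * C" "c\<^sup>2 = 1/4 - a\<^sup>2" "S\<^sup>2 = 1 - C\<^sup>2"
    using a unfolding defs(1-4) by (simp_all add: z_sq c_sq sin_squared_eq)
  have K: "K = z * S / w"
  proof -
    have "z * S / 2 - a * u * K = 0" using crit by (simp add: balance_def defs)
    then have "K * w = z * S" by (simp add: defs(7))
    then show ?thesis using w by (simp add: eq_divide_eq)
  qed
  \<comment> \<open>Here \<open>w/2 = a (2a + C) = D - c\<^sup>2\<close>, which simplifies the formula for the derivative of
    \<open>s1\<close> at a critical point to \<open>- K/z\<close>.\<close>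
  have "modsq a (s1 a) = c\<^sup>2 + w / 2"
    unfolding rel(2) by (simp add: modsq_def defs(3,6,7)) (simp add: algebra_simps power2_eq_square)
  then have "- (modsq a (s1 a) * K - z * S / 2) / (c\<^sup>2 * z) = s'"
    unfolding K s'_def using pos w by (simp add: divide_simps) (simp add: algebra_simps)
  then have s': "(s1 has_real_derivative s') (at a)"
    using s1_deriv[OF a] by (simp add: defs)
  obtain r where r: "r \<le> 0" "((\<lambda>b. area_rate b (s1 a)) has_real_derivative r) (at a)"
    using area_rate_deriv_param[OF a less_imp_le[OF s1(1)]] .
  have Kd: "((\<lambda>a. area_rate a (s1 a)) has_real_derivative r + C / (2 * z) * s') (at a)"
    unfolding defs
  proof (rule has_real_derivative_along_graph[where U = params and F = area_rate
        and Fs = "\<lambda>a s. cos (2 * s) / (2 * z_prof a s)", OF _ a r(2) _ _ s'])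
    show "continuous_on (params \<times> UNIV) (\<lambda>(a, s). cos (2 * s) / (2 * z_prof a s))"
      unfolding split_beta by (intro continuous_intros) (auto simp: profiles_nonzero)
  qed (auto intro: area_rate_deriv)
  have zd: "((\<lambda>a. z_prof a (s1 a)) has_real_derivative C / (2 * z) + - (a * S) / z * s') (at a)"
    unfolding defs
  proof (rule has_real_derivative_along_graph[where U = params and F = z_prof
        and Fs = "\<lambda>a s. - (a * sin (2 * s)) / z_prof a s", OF _ a _ _ _ s'])
    show "continuous_on (params \<times> UNIV) (\<lambda>(a, s). - (a * sin (2 * s)) / z_prof a s)"
      unfolding split_beta by (intro continuous_intros) (auto simp: profiles_nonzero)
  qed (use a in \<open>simp_all only: z_deriv z_deriv_param open_greaterThanLessThan\<close>)
  define z' where "z' = C / (2 * z) + - (a * S) / z * s'"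
  have num: "((\<lambda>a. z_prof a (s1 a) * sin (2 * s1 a)) has_real_derivative
      z' * S + 2 * z * C * s') (at a)"
  proof -
    have "((\<lambda>a. sin (2 * s1 a)) has_real_derivative 2 * C * s') (at a)"
      unfolding defs(3) by (auto intro!: derivative_eq_intros s')
    from DERIV_mult[OF zd this] show ?thesis
      by (simp add: z'_def defs(1,4) ac_simps)
  qed
  have den: "((\<lambda>a. 2 * a * (2 * a + cos (2 * s1 a))) has_real_derivative
      2 * u + 2 * a * (2 - 2 * S * s')) (at a)"
    unfolding defs(3,4,6) by (auto intro!: derivative_eq_intros s' simp: algebra_simps)
  have nz: "2 * a * (2 * a + cos (2 * s1 a)) \<noteq> 0"
    using pos by (simp add: defs)
  define Q' where "Q' = ((z' * S + 2 * z * C * s') * w - z * S * (2 * u + 2 * a * (2 - 2 * S * s'))) / w\<^sup>2"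
  have "((\<lambda>a. excess a (s1 a)) has_real_derivative r + C / (2 * z) * s' - Q') (at a)"
    unfolding excess_def
    using DERIV_diff[OF Kd DERIV_divide[OF num den nz]]
    by (simp add: defs(1,3,4,6,7) Q'_def power2_eq_square)
  moreover have "C / (2 * z) * s' - Q' < 0"
  proof -
    define f where "f = 2 + 3 * (2 * a)\<^sup>2 + 9 * (2 * a) * C + 2 * (2 * a) ^ 3 * C
      + 5 * (2 * a)\<^sup>2 * C\<^sup>2 + 2 * C\<^sup>2 + (2 * a) * C ^ 3"
    have "C / (2 * z) * s' - Q'
      = - S * (2 * C * w\<^sup>2 + 2 * a * S\<^sup>2 * w - 4 * z\<^sup>2 * w * (C + u + 2 * a) - 8 * a * z\<^sup>2 * S\<^sup>2) / (2 * z * w ^ 3)"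
      unfolding Q'_def z'_def s'_def using pos w
      by (simp add: divide_simps) (simp add: algebra_simps power2_eq_square power3_eq_cube)
    also have "2 * C * w\<^sup>2 + 2 * a * S\<^sup>2 * w - 4 * z\<^sup>2 * w * (C + u + 2 * a) - 8 * a * z\<^sup>2 * S\<^sup>2
      = - (2 * a) * f"
      unfolding rel defs(6,7) f_def
      by (simp add: algebra_simps power2_eq_square power3_eq_cube power4_eq_xxxx)
    also have "- S * (- (2 * a) * f) / (2 * z * w ^ 3) < 0"
    proof -
      have "0 < f" unfolding f_def
        using pos neg by (intro crossing_polynomial_pos) (auto simp: defs)
      moreover have "w ^ 3 < 0" using w by (simp add: power3_eq_cube mult_neg_neg mult_pos_neg)
      ultimately show ?thesis using S pos
        by (intro divide_pos_neg mult_pos_neg) (auto simp: zero_less_mult_iff)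
    qed
    finally show ?thesis .
  qed
  ultimately show "\<exists>r. ((\<lambda>a. excess a (s1 a)) has_real_derivative r) (at a) \<and> r < 0"
    using r(1) by (intro exI[of _ "r + C / (2 * z) * s' - Q'"] conjI) auto
qed

text \<open>Near a critical point the factor \<open>- a (2a + C)\<close> that relates \<open>balance\<close> to \<open>excess\<close> is positive,
  so the sign of \<open>balance\<close> is that of a function with negative derivative at its zero.\<close>

lemma balance_changes_sign:
  assumes a: "a \<in> params" and crit: "balance a (s1 a) = 0"
  obtains d where "0 < d" "{a - d<..<a + d} \<subseteq> params"
    "\<And>b. a - d < b \<Longrightarrow> b < a \<Longrightarrow> 0 < balance b (s1 b)"
    "\<And>b. a < b \<Longrightarrow> b < a + d \<Longrightarrow> balance b (s1 b) < 0"
proof -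
  note neg = excess_s1_deriv_neg(1)[OF a crit]
  obtain r where r: "((\<lambda>a. excess a (s1 a)) has_real_derivative r) (at a)" "r < 0"
    using excess_s1_deriv_neg(2)[OF a crit] by blast
  obtain d1 where d1: "0 < d1" "\<And>h. 0 < h \<Longrightarrow> h < d1 \<Longrightarrow> excess a (s1 a) < excess (a - h) (s1 (a - h))"
    using DERIV_neg_dec_left[OF r] by blast
  obtain d2 where d2: "0 < d2" "\<And>h. 0 < h \<Longrightarrow> h < d2 \<Longrightarrow> excess (a + h) (s1 (a + h)) < excess a (s1 a)"
    using DERIV_neg_dec_right[OF r] by blast
  have "isCont (\<lambda>b. 2 * b + cos (2 * s1 b)) a"
    using s1_isCont[OF a] by (intro continuous_intros)
  then have "((\<lambda>b. 2 * b + cos (2 * s1 b)) \<longlongrightarrow> 2 * a + cos (2 * s1 a)) (nhds a)"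
    unfolding isCont_def by (rule tendsto_at_iff_tendsto_nhds[THEN iffD1])
  then have "\<forall>\<^sub>F b in nhds a. 2 * b + cos (2 * s1 b) < 0"
    using neg by (rule order_tendstoD(2))
  then obtain d3 where d3: "0 < d3" "\<And>b. dist b a < d3 \<Longrightarrow> 2 * b + cos (2 * s1 b) < 0"
    unfolding eventually_nhds_metric by blast
  have ex0: "excess a (s1 a) = 0"
    using crit a neg balance_eq_excess[OF a, of "s1 a"] by auto
  \<comment> \<open>The last two entries keep the interval inside the parameter range.\<close>
  define d where "d = Min {d1, d2, d3, a, 1/2 - a}"
  have d: "0 < d" "d \<le> d1" "d \<le> d2" "d \<le> d3" "d \<le> a" "d \<le> 1/2 - a"
    using d1(1) d2(1) d3(1) a by (auto simp: d_def)
  have sub: "b \<in> params" if "a - d < b" "b < a + d" for b using that d by auto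
  have bal: "balance b (s1 b) = - (b * (2 * b + cos (2 * s1 b))) * excess b (s1 b)"
    "0 < - (b * (2 * b + cos (2 * s1 b)))" if "a - d < b" "b < a + d" for b
  proof -
    have u: "2 * b + cos (2 * s1 b) < 0" using that d by (intro d3(2)) (auto simp: dist_real_def)
    then show "balance b (s1 b) = - (b * (2 * b + cos (2 * s1 b))) * excess b (s1 b)"
      by (intro balance_eq_excess sub that) auto
    show "0 < - (b * (2 * b + cos (2 * s1 b)))"
      using sub[OF that] u by (simp add: mult_pos_neg)
  qed
  show thesis
  proof (rule that[OF d(1)])
    show "{a - d<..<a + d} \<subseteq> params" using d by auto
    show "0 < balance b (s1 b)" if b: "a - d < b" "b < a" for b
    proof -
      have "0 < excess b (s1 b)" using d1(2)[of "a - b"] b d ex0 by simp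
      then show ?thesis using bal[of b] b d by (simp add: mult_neg_pos)
    qed
    show "balance b (s1 b) < 0" if b: "a < b" "b < a + d" for b
    proof -
      have "excess b (s1 b) < 0" using d2(2)[of "b - a"] b d ex0 by simp
      then show ?thesis using bal[of b] b d by (simp add: mult_neg_neg)
    qed
  qed
qed

section \<open>Surfaces of revolution in the three-sphere\<close>

lemma vector4_nth [simp]:
  fixes v :: "real^4"
  shows "(vector [p, q, r, s] :: real^4) $ 1 = p" "(vector [p, q, r, s] :: real^4) $ 2 = q"
    "(vector [p, q, r, s] :: real^4) $ 3 = r" "(vector [p, q, r, s] :: real^4) $ 4 = s"
  unfolding vector_def by simp_all

lemma vector4_axis:
  "(vector [p, q, r, s] :: real^4) = p *\<^sub>R axis 1 1 + q *\<^sub>R axis 2 1 + r *\<^sub>R axis 3 1 + s *\<^sub>R axis 4 1"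
  by (simp add: vec_eq_iff forall_4 axis_def)

lemma inner_vector4 [simp]:
  "(vector [p, q, r, s] :: real^4) \<bullet> vector [p', q', r', s'] = p * p' + q * q' + r * r' + s * s'"
  by (simp add: inner_vec_def sum_4)

lemma vector4_has_vector_derivative:
  assumes "(f1 has_real_derivative f1') (at t)" "(f2 has_real_derivative f2') (at t)"
    "(f3 has_real_derivative f3') (at t)" "(f4 has_real_derivative f4') (at t)"
  shows "((\<lambda>t. vector [f1 t, f2 t, f3 t, f4 t] :: real^4) has_vector_derivative
    vector [f1', f2', f3', f4']) (at t)"
  unfolding vector4_axis
  by (intro derivative_intros has_vector_derivative_scaleR[where g' = 0, THEN has_vector_derivative_eq_rhs])
     (simp_all add: assms)

lemma vector4_continuous [continuous_intros]:
  assumes "continuous_on A f1" "continuous_on A f2" "continuous_on A f3" "continuous_on A f4"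
  shows "continuous_on A (\<lambda>p. vector [f1 p, f2 p, f3 p, f4 p] :: real^4)"
  unfolding vector4_axis by (intro continuous_intros assms)

definition revolve ::
    "(real \<Rightarrow> real) \<Rightarrow> (real \<Rightarrow> real) \<Rightarrow> (real \<Rightarrow> real) \<Rightarrow> real \<times> real \<Rightarrow> real^4" where
  "revolve x y z = (\<lambda>(s, \<theta>). vector [x s, y s, z s * cos \<theta>, z s * sin \<theta>])"

text \<open>The derivative of \<open>revolve x y z\<close> in the angle, for every \<open>x\<close> and \<open>y\<close>.\<close>

definition angular :: "(real \<Rightarrow> real) \<Rightarrow> real \<times> real \<Rightarrow> real^4" where
  "angular z = (\<lambda>(s, \<theta>). vector [0, 0, - (z s * sin \<theta>), z s * cos \<theta>])"

lemma d1_revolve: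
  assumes "\<And>s. (x has_real_derivative x' s) (at s)" "\<And>s. (y has_real_derivative y' s) (at s)"
    "\<And>s. (z has_real_derivative z' s) (at s)"
  shows "d1 (revolve x y z) = revolve x' y' z'"
proof
  fix p :: "real \<times> real"
  have "((\<lambda>s. vector [x s, y s, z s * cos (snd p), z s * sin (snd p)] :: real^4) has_vector_derivative
      vector [x' (fst p), y' (fst p), z' (fst p) * cos (snd p), z' (fst p) * sin (snd p)]) (at (fst p))"
    by (intro vector4_has_vector_derivative assms DERIV_cmult_right)
  then show "d1 (revolve x y z) p = revolve x' y' z' p"
    unfolding d1_def revolve_def by (simp add: split_beta vector_derivative_at)
qed

lemma d2_revolve: "d2 (revolve x y z) = angular z"
proof
  fix p :: "real \<times> real"
  have "((\<lambda>\<theta>. vector [x (fst p), y (fst p), z (fst p) * cos \<theta>, z (fst p) * sin \<theta>] :: real^4)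
      has_vector_derivative
      vector [0, 0, - (z (fst p) * sin (snd p)), z (fst p) * cos (snd p)]) (at (snd p))"
    by (intro vector4_has_vector_derivative) (auto intro!: derivative_eq_intros)
  then show "d2 (revolve x y z) p = angular z p"
    unfolding d2_def revolve_def angular_def by (simp add: split_beta vector_derivative_at)
qed

lemma d1_angular:
  assumes "\<And>s. (z has_real_derivative z' s) (at s)"
  shows "d1 (angular z) = angular z'"
proof
  fix p :: "real \<times> real"
  have "((\<lambda>s. vector [0, 0, - (z s * sin (snd p)), z s * cos (snd p)] :: real^4) has_vector_derivative
      vector [0, 0, - (z' (fst p) * sin (snd p)), z' (fst p) * cos (snd p)]) (at (fst p))"
    by (intro vector4_has_vector_derivative DERIV_minus DERIV_cmult_right assms DERIV_const)
  then show "d1 (angular z) p = angular z' p"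
    unfolding d1_def angular_def by (simp add: split_beta vector_derivative_at)
qed

lemma d2_angular: "d2 (angular z) = revolve (\<lambda>_. 0) (\<lambda>_. 0) (\<lambda>s. - z s)"
proof
  fix p :: "real \<times> real"
  have "((\<lambda>\<theta>. vector [0, 0, - (z (fst p) * sin \<theta>), z (fst p) * cos \<theta>] :: real^4)
      has_vector_derivative
      vector [0, 0, - z (fst p) * cos (snd p), - z (fst p) * sin (snd p)]) (at (snd p))"
    by (intro vector4_has_vector_derivative) (auto intro!: derivative_eq_intros)
  then show "d2 (angular z) p = revolve (\<lambda>_. 0) (\<lambda>_. 0) (\<lambda>s. - z s) p"
    unfolding d2_def revolve_def angular_def by (simp add: split_beta vector_derivative_at)
qed

lemma inner_revolve:
  "revolve x y z p \<bullet> revolve x' y' z' p = x (fst p) * x' (fst p) + y (fst p) * y' (fst p) + z (fst p) * z' (fst p)"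
proof -
  have "z s * cos \<theta> * (z' s * cos \<theta>) + z s * sin \<theta> * (z' s * sin \<theta>) = z s * z' s" for s \<theta>
    using sin_cos_squared_add[of \<theta>] by algebra
  then show ?thesis by (simp add: revolve_def split_beta)
qed

lemma inner_angular: "angular z p \<bullet> angular z' p = z (fst p) * z' (fst p)"
proof -
  have "z s * sin \<theta> * (z' s * sin \<theta>) + z s * cos \<theta> * (z' s * cos \<theta>) = z s * z' s" for s \<theta>
    using sin_cos_squared_add[of \<theta>] by algebra
  then show ?thesis by (simp add: angular_def split_beta)
qed

lemma inner_revolve_angular: "revolve x y z p \<bullet> angular z' p = 0"
  by (simp add: revolve_def angular_def split_beta)

lemma immersion_eq_revolve: "immersion a = revolve (x_prof a) (y_prof a) (z_prof a)"
  by (simp add: immersion_def revolve_def)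

text \<open>Radial and tangential components \<open>A\<close>, \<open>B\<close> of the first two coordinates with respect to the
  polar angle \<open>\<beta>\<close>. In this moving frame the immersion, its derivatives and its normal have
  coefficients that are free of \<open>\<beta>\<close>.\<close>

definition in_frame :: "real \<Rightarrow> (real \<Rightarrow> real) \<Rightarrow> (real \<Rightarrow> real) \<Rightarrow> (real \<Rightarrow> real) \<Rightarrow> real \<times> real \<Rightarrow> real^4" where
  "in_frame a A B z = revolve (\<lambda>s. A s * cos (beta a s) - B s * sin (beta a s))
     (\<lambda>s. A s * sin (beta a s) + B s * cos (beta a s)) z"

lemma inner_in_frame:
  "in_frame a A B z p \<bullet> in_frame a A' B' z' p = A (fst p) * A' (fst p) + B (fst p) * B' (fst p) + z (fst p) * z' (fst p)"
proof -
  have "(A * c - B * s) * (A' * c - B' * s) + (A * s + B * c) * (A' * s + B' * c)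
      = (A * A' + B * B') * (s\<^sup>2 + c\<^sup>2)" for A B A' B' c s :: real
    by (simp add: algebra_simps power2_eq_square)
  then show ?thesis by (simp add: in_frame_def inner_revolve)
qed

lemma inner_in_frame_angular: "in_frame a A B z p \<bullet> angular z' p = 0"
  by (simp add: in_frame_def inner_revolve_angular)

lemma d1_in_frame:
  assumes a: "a \<in> params"
    and "\<And>s. (A has_real_derivative A' s) (at s)" "\<And>s. (B has_real_derivative B' s) (at s)"
    "\<And>s. (z has_real_derivative z' s) (at s)"
  shows "d1 (in_frame a A B z)
    = in_frame a (\<lambda>s. A' s - B s * omega a s) (\<lambda>s. B' s + A s * omega a s) z'"
  unfolding in_frame_def
  by (rule d1_revolve) (auto intro!: derivative_eq_intros assms beta_deriv[OF a] simp: algebra_simps)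

lemma d2_in_frame: "d2 (in_frame a A B z) = angular z"
  by (simp add: in_frame_def d2_revolve)

lemma immersion_in_frame: "immersion a = in_frame a (\<lambda>s. sqrt (lam_prof a s)) (\<lambda>_. 0) (z_prof a)"
  by (simp add: immersion_eq_revolve in_frame_def x_prof_def[abs_def] y_prof_def[abs_def])

lemma d1_immersion:
  assumes a: "a \<in> params"
  shows "d1 (immersion a) = in_frame a (\<lambda>s. a * sin (2 * s) / sqrt (lam_prof a s))
    (\<lambda>s. c_const a / (z_prof a s * sqrt (lam_prof a s))) (\<lambda>s. - (a * sin (2 * s)) / z_prof a s)"
proof -
  have "sqrt (lam_prof a s) * omega a s = c_const a / (z_prof a s * sqrt (lam_prof a s))" for s
    using lam_pos[OF a, of s] z_pos[OF a, of s] sqrt_lam_sq[OF a, of s]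
    by (simp add: omega_def divide_simps power2_eq_square)
  then show ?thesis
    unfolding immersion_in_frame
    using d1_in_frame[OF a sqrt_lam_deriv[OF a] DERIV_const z_deriv[OF a]] by simp
qed

lemma d2_immersion: "d2 (immersion a) = angular (z_prof a)"
  by (simp add: immersion_in_frame d2_in_frame)

text \<open>The profile curve has unit speed because \<open>\<lambda> z\<^sup>2 = c\<^sup>2 + a\<^sup>2 S\<^sup>2\<close>.\<close>

lemma speed_sq:
  assumes a: "a \<in> params"
  shows "(a * sin (2 * s))\<^sup>2 / lam_prof a s + (c_const a)\<^sup>2 / ((z_prof a s)\<^sup>2 * lam_prof a s)
    + (a * sin (2 * s))\<^sup>2 / (z_prof a s)\<^sup>2 = 1"
proof -
  note pos = lam_pos[OF a, of s] z_pos[OF a, of s]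
  have "(a * sin (2 * s))\<^sup>2 / lam_prof a s + (c_const a)\<^sup>2 / ((z_prof a s)\<^sup>2 * lam_prof a s)
      + (a * sin (2 * s))\<^sup>2 / (z_prof a s)\<^sup>2
    = ((a * sin (2 * s))\<^sup>2 * (lam_prof a s + (z_prof a s)\<^sup>2) + (c_const a)\<^sup>2)
      / (lam_prof a s * (z_prof a s)\<^sup>2)"
    using pos by (simp add: divide_simps) (simp add: algebra_simps)
  also have "(a * sin (2 * s))\<^sup>2 * (lam_prof a s + (z_prof a s)\<^sup>2) + (c_const a)\<^sup>2
      = lam_prof a s * (z_prof a s)\<^sup>2"
    by (simp add: lam_plus_z_sq[OF a] lam_z_sq[OF a] power_mult_distrib)
  also have "\<dots> / \<dots> = 1"
    using pos by simp
  finally show ?thesis .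
qed

lemma g11_immersion: "a \<in> params \<Longrightarrow> g11 (immersion a) p = 1"
  using speed_sq[of a "fst p"] sqrt_lam_sq[of a "fst p"]
  by (simp add: g11_def d1_immersion inner_in_frame power_divide power_mult_distrib flip: power2_eq_square)

lemma g12_immersion: "a \<in> params \<Longrightarrow> g12 (immersion a) p = 0"
  by (simp add: g12_def d1_immersion d2_immersion inner_in_frame_angular)

lemma g22_immersion: "g22 (immersion a) p = (z_prof a (fst p))\<^sup>2"
  by (simp add: g22_def d2_immersion inner_angular power2_eq_square)

lemma gdet_immersion: "a \<in> params \<Longrightarrow> gdet (immersion a) p = (z_prof a (fst p))\<^sup>2"
  by (simp add: gdet_def g11_immersion g12_immersion g22_immersion)

lemma sqrt_gdet_immersion: "a \<in> params \<Longrightarrow> sqrt (gdet (immersion a) p) = z_prof a (fst p)"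
  using z_pos[of a "fst p"] by (simp add: gdet_immersion)

lemma primitive_odd:
  fixes F f :: "real \<Rightarrow> real"
  assumes F: "\<And>s. (F has_real_derivative f s) (at s)" and even: "\<And>s. f (- s) = f s" and "F 0 = 0"
  shows "F (- s) = - F s"
proof -
  have "((\<lambda>s. F s + F (- s)) has_real_derivative 0) (at s)" for s
  proof -
    have "((\<lambda>s. F s + F (- s)) has_real_derivative f s + f (- s) * - 1) (at s)"
      by (intro DERIV_add F DERIV_chain2[OF F] DERIV_minus DERIV_ident)
    then show ?thesis by (simp add: even)
  qed
  then have "F s + F (- s) = F 0 + F (- 0)" by (intro DERIV_isconst_all[of "\<lambda>s. F s + F (- s)"]) simp
  then show ?thesis using assms(3) by simp
qed

lemma half_area_0 [simp]: "half_area a 0 = 0"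
  by (simp add: half_area_def flip: zero_ereal_def)

lemma profiles_even [simp]: "z_prof a (- s) = z_prof a s" "lam_prof a (- s) = lam_prof a s"
  by (simp_all add: z_prof_def lam_prof_def)

lemma area_rate_odd: "a \<in> params \<Longrightarrow> area_rate a (- s) = - area_rate a s"
  by (rule primitive_odd[OF area_rate_deriv]) simp_all

section \<open>Area of the annuli\<close>

lemma area_eq:
  assumes a: "a \<in> params"
  shows "area a = 4 * pi * half_area a (s1 a)"
proof -
  let ?s = "s1 a"
  have s: "- ?s \<le> ?s" using s1_characterization(1)[OF a] by simp
  have "area a = integral (cbox (- ?s, 0) (?s, 2 * pi)) (\<lambda>p. z_prof a (fst p))"
    unfolding area_def surface_area_def sqrt_gdet_immersion[OF a]
    by (simp only: cbox_Pair_eq cbox_interval[symmetric, where 'a = real])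
  also have "\<dots> = integral (cbox (- ?s) ?s) (\<lambda>s. integral (cbox 0 (2 * pi)) (\<lambda>\<theta>. z_prof a s))"
    by (subst integral_prod_continuous) (auto intro!: continuous_intros)
  also have "\<dots> = integral {- ?s..?s} (\<lambda>s. 2 * pi * z_prof a s)"
    by (simp add: cbox_interval)
  also have "\<dots> = 2 * pi * integral {- ?s..?s} (z_prof a)"
    by simp
  also have "integral {- ?s..?s} (z_prof a) = half_area a ?s - half_area a (- ?s)"
    using s by (intro integral_unique fundamental_theorem_of_calculus)
       (auto simp flip: has_real_derivative_iff_has_vector_derivative
             intro: has_field_derivative_at_within half_area_deriv)
  also have "half_area a (- ?s) = - half_area a ?s"
    by (rule primitive_odd[OF half_area_deriv]) simp_all
  finally show ?thesis by simp
qed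

lemma area_deriv:
  assumes a: "a \<in> params"
  shows "(area has_real_derivative 4 * pi * (balance a (s1 a) / (c_const a)\<^sup>2)) (at a)"
  by (rule has_field_derivative_transform_within_open[OF DERIV_cmult[OF half_area_s1_deriv[OF a]], where S = params])
     (use a in \<open>simp_all add: area_eq del: greaterThanLessThan_iff\<close>)

lemma critical_iff_balance:
  assumes a: "a \<in> params"
  shows "critical_point area a \<longleftrightarrow> balance a (s1 a) = 0"
    and "critical_point radius a \<longleftrightarrow> balance a (s1 a) = 0"
proof -
  have "(f has_real_derivative 0) (at a) \<longleftrightarrow> r = 0"
    if "(f has_real_derivative r) (at a)" for f and r :: real
    using DERIV_unique[OF that, of 0] that by metis
  from this[OF area_deriv[OF a]] this[OF radius_deriv[OF a]]
  show "critical_point area a \<longleftrightarrow> balance a (s1 a) = 0"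
    and "critical_point radius a \<longleftrightarrow> balance a (s1 a) = 0"
    using c_pos[OF a] z_pos[OF a, of "s1 a"] by (simp_all add: critical_point_def)
qed

text \<open>The derivative of the area is a positive multiple of \<open>balance\<close> and so changes sign from plus
  to minus.\<close>

lemma strict_local_max_area:
  assumes a: "a \<in> params" and crit: "balance a (s1 a) = 0"
  shows "strict_local_max area a"
proof -
  obtain d where d: "0 < d" "{a - d<..<a + d} \<subseteq> params"
    and left: "\<And>b. a - d < b \<Longrightarrow> b < a \<Longrightarrow> 0 < balance b (s1 b)"
    and right: "\<And>b. a < b \<Longrightarrow> b < a + d \<Longrightarrow> balance b (s1 b) < 0"
    using balance_changes_sign[OF a crit] by blast
  have der: "(area has_real_derivative 4 * pi * (balance b (s1 b) / (c_const b)\<^sup>2)) (at b)"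
    if "a - d < b" "b < a + d" for b
    using d(2) that by (intro area_deriv) auto
  have cont: "continuous_on {l..r} area" if "a - d < l" "r < a + d" for l r
    by (rule DERIV_continuous_on, rule has_field_derivative_at_within, rule der) (use that in auto)
  have c: "0 < (c_const b)\<^sup>2" if "a - d < b" "b < a + d" for b
    using c_pos[of b] d(2) that by fastforce
  have "area b < area a" if b: "a - d < b" "b < a + d" "b \<noteq> a" for b
  proof (cases "b < a")
    case True
    show ?thesis
    proof (rule DERIV_pos_imp_increasing_open[OF True _ cont])
      fix x assume x: "b < x" "x < a"
      then have "0 < 4 * pi * (balance x (s1 x) / (c_const x)\<^sup>2)"
        using left[of x] c[of x] b d(1) by simp
      with der[of x] x b show "\<exists>y. (area has_real_derivative y) (at x) \<and> 0 < y" by force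
    qed (use b d in auto)
  next
    case False
    then have "a < b" using b by simp
    then show ?thesis
    proof (rule DERIV_neg_imp_decreasing_open[OF _ _ cont])
      fix x assume x: "a < x" "x < b"
      then have "4 * pi * (balance x (s1 x) / (c_const x)\<^sup>2) < 0"
        using right[of x] c[of x] b d(1) by (simp add: divide_neg_pos mult_pos_neg)
      with der[of x] x b show "\<exists>y. (area has_real_derivative y) (at x) \<and> y < 0" by force
    qed (use b d in auto)
  qed
  then have "\<forall>b. b \<noteq> a \<and> dist b a < d \<longrightarrow> area b < area a"
    by (auto simp: dist_real_def abs_if split: if_splits)
  then show ?thesis
    unfolding strict_local_max_def eventually_at using d(1) by auto
qed

lemma radius_max_imp_balance:
  assumes a: "a \<in> params" and max: "\<And>b. b \<in> params \<Longrightarrow> radius b \<le> radius a"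
  shows "balance a (s1 a) = 0"
proof -
  have "balance a (s1 a) / ((c_const a)\<^sup>2 * z_prof a (s1 a)) = 0"
  proof (rule DERIV_local_max[OF radius_deriv[OF a], of "min a (1/2 - a)"])
    show "\<forall>b. \<bar>a - b\<bar> < min a (1/2 - a) \<longrightarrow> radius b \<le> radius a"
      by (auto intro!: max)
  qed (use a in auto)
  then show ?thesis using c_pos[OF a] z_pos[OF a, of "s1 a"] by simp
qed

section \<open>Unit normal and second fundamental form\<close>

text \<open>In the moving frame this is the cross product of the position of the profile curve and its
  velocity.\<close>

definition normal_field :: "real \<Rightarrow> real \<times> real \<Rightarrow> real^4" where
  "normal_field a = in_frame a (\<lambda>s. - c_const a / sqrt (lam_prof a s))
     (\<lambda>s. a * sin (2 * s) / (z_prof a s * sqrt (lam_prof a s))) (\<lambda>s. c_const a / z_prof a s)"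

lemma normal_field_unit:
  assumes a: "a \<in> params"
  shows "normal_field a p \<bullet> normal_field a p = 1" and "normal_field a p \<bullet> immersion a p = 0"
    and "normal_field a p \<bullet> d1 (immersion a) p = 0" and "normal_field a p \<bullet> d2 (immersion a) p = 0"
proof -
  define z c l S where defs: "z = z_prof a (fst p)" "c = c_const a" "l = sqrt (lam_prof a (fst p))"
    "S = sin (2 * fst p)"
  have pos: "z > 0" "c > 0" "l > 0"
    using z_pos[OF a] c_pos[OF a] lam_pos[OF a] by (auto simp: defs)
  have rel: "l\<^sup>2 + z\<^sup>2 = 1" "l\<^sup>2 * z\<^sup>2 = c\<^sup>2 + a\<^sup>2 * S\<^sup>2"
    unfolding defs sqrt_lam_sq[OF a] by (simp_all add: lam_plus_z_sq[OF a] lam_z_sq[OF a])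
  have "normal_field a p \<bullet> normal_field a p = c\<^sup>2 / l\<^sup>2 + (a * S)\<^sup>2 / (z * l)\<^sup>2 + c\<^sup>2 / z\<^sup>2"
    by (simp add: normal_field_def inner_in_frame defs power2_eq_square)
  also have "\<dots> = (c\<^sup>2 * (l\<^sup>2 + z\<^sup>2) + a\<^sup>2 * S\<^sup>2) / (l\<^sup>2 * z\<^sup>2)"
    using pos by (simp add: divide_simps power_mult_distrib) (simp add: algebra_simps)
  also have "\<dots> = 1" using pos by (simp add: rel(1) flip: rel(2))
  finally show "normal_field a p \<bullet> normal_field a p = 1" .
  show "normal_field a p \<bullet> immersion a p = 0"
    unfolding normal_field_def immersion_in_frame inner_in_frame
    using pos by (simp add: defs)
  have "normal_field a p \<bullet> d1 (immersion a) p = a * S * c * (1 - (l\<^sup>2 + z\<^sup>2)) / (z\<^sup>2 * l\<^sup>2)"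
    unfolding normal_field_def d1_immersion[OF a] inner_in_frame defs[symmetric]
    using pos by (simp add: divide_simps) (simp add: algebra_simps power2_eq_square)
  then show "normal_field a p \<bullet> d1 (immersion a) p = 0" by (simp add: rel)
  show "normal_field a p \<bullet> d2 (immersion a) p = 0"
    by (simp add: normal_field_def d2_immersion inner_in_frame_angular)
qed

lemma beta_continuous:
  assumes "a \<in> params" "continuous_on A f"
  shows "continuous_on A (\<lambda>p. beta a (f p))"
  by (rule continuous_on_compose2[of UNIV "beta a"])
     (use assms beta_deriv in \<open>auto intro!: DERIV_continuous_on[where D = "omega a"]\<close>)

lemma annulus_normal_field:
  assumes a: "a \<in> params"
  shows "annulus_normal a (normal_field a)"
proof -
  have "continuous_on (strip a) (normal_field a)"
    unfolding normal_field_def in_frame_def revolve_def split_beta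
    by (intro continuous_intros beta_continuous[OF a])
       (use lam_pos[OF a] in \<open>auto simp: profiles_nonzero[OF a]\<close>)
  then show ?thesis
    using normal_field_unit[OF a]
    by (auto simp: annulus_normal_def unit_normal_def periodic_on_strip_def norm_eq_1
        normal_field_def in_frame_def revolve_def)
qed

text \<open>The function \<open>a S/z\<close> is \<open>- z'\<close>, so this is the profile equation \<open>z'' = - z + c\<^sup>2/z\<^sup>3\<close>.\<close>

lemma sin_over_z_deriv:
  assumes a: "a \<in> params"
  shows "((\<lambda>s. a * sin (2 * s) / z_prof a s) has_real_derivative
    z_prof a s - (c_const a)\<^sup>2 / z_prof a s ^ 3) (at s)"
proof -
  define z C S where defs: "z = z_prof a s" "C = cos (2 * s)" "S = sin (2 * s)"
  have pos: "z > 0" using z_pos[OF a] by (auto simp: defs)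
  have rel: "z\<^sup>2 = 1/2 + a * C" "S\<^sup>2 = 1 - C\<^sup>2"
    using a unfolding defs by (simp_all add: z_sq sin_squared_eq)
  have "((\<lambda>s. a * sin (2 * s) / z_prof a s) has_real_derivative
     (a * (2 * C) * z - a * S * (- (a * S) / z)) / z\<^sup>2) (at s)"
    unfolding defs using pos a
    by (auto intro!: derivative_eq_intros z_deriv simp: defs power2_eq_square)
  also have "(a * (2 * C) * z - a * S * (- (a * S) / z)) / z\<^sup>2 = (2 * a * C * z\<^sup>2 + a\<^sup>2 * S\<^sup>2) / z ^ 3"
    using pos by (simp add: divide_simps) (simp add: algebra_simps power2_eq_square power3_eq_cube)
  also have "2 * a * C * z\<^sup>2 + a\<^sup>2 * S\<^sup>2 = (z\<^sup>2)\<^sup>2 - (c_const a)\<^sup>2"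
    unfolding rel c_sq[OF a] by (simp add: algebra_simps power2_eq_square)
  also have "((z\<^sup>2)\<^sup>2 - (c_const a)\<^sup>2) / z ^ 3 = z - (c_const a)\<^sup>2 / z ^ 3"
    using pos by (simp add: divide_simps) (simp add: power4_eq_xxxx power3_eq_cube)
  finally show ?thesis by (simp add: defs)
qed

text \<open>The principal curvature along the profile, \<open>c/z\<^sup>2\<close>, is opposite to the one along the
  parallels; this is minimality.\<close>

lemma d1_d1_immersion_normal:
  assumes a: "a \<in> params"
  shows "d1 (d1 (immersion a)) p \<bullet> normal_field a p = c_const a / (z_prof a (fst p))\<^sup>2"
proof -
  define s where "s = fst p"
  define z c l C S where defs: "z = z_prof a s" "c = c_const a" "l = sqrt (lam_prof a s)"
    "C = cos (2 * s)" "S = sin (2 * s)"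
  have pos: "z > 0" "c > 0" "l > 0"
    using z_pos[OF a] c_pos[OF a] lam_pos[OF a] by (auto simp: defs)
  have rel: "z\<^sup>2 = 1/2 + a * C" "c\<^sup>2 = 1/4 - a\<^sup>2" "l\<^sup>2 = 1/2 - a * C" "S\<^sup>2 = 1 - C\<^sup>2"
    using a unfolding defs by (simp_all add: z_sq c_sq sin_squared_eq sqrt_lam_sq[OF a]) (simp add: lam_prof_def)
  define A' where "A' s = (a * (2 * cos (2 * s)) * sqrt (lam_prof a s)
      - a * sin (2 * s) * (a * sin (2 * s) / sqrt (lam_prof a s))) / (sqrt (lam_prof a s))\<^sup>2" for s
  define B' where "B' s = - (c_const a * (- (a * sin (2 * s)) / z_prof a s * sqrt (lam_prof a s)
      + z_prof a s * (a * sin (2 * s) / sqrt (lam_prof a s)))) / (z_prof a s * sqrt (lam_prof a s))\<^sup>2" for s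
  have lpos: "0 < sqrt (lam_prof a s)" for s using lam_pos[OF a] by simp
  have A: "((\<lambda>s. a * sin (2 * s) / sqrt (lam_prof a s)) has_real_derivative A' s) (at s)" for s
  proof -
    have "((\<lambda>s. a * sin (2 * s)) has_real_derivative a * (2 * cos (2 * s))) (at s)"
      by (auto intro!: derivative_eq_intros)
    from DERIV_divide[OF this sqrt_lam_deriv[OF a, of s]] show ?thesis
      using lpos[of s] by (simp add: A'_def power2_eq_square)
  qed
  have B: "((\<lambda>s. c_const a / (z_prof a s * sqrt (lam_prof a s))) has_real_derivative B' s) (at s)" for s
    using DERIV_divide[OF DERIV_const DERIV_mult[OF z_deriv[OF a, of s] sqrt_lam_deriv[OF a, of s]], of "c_const a"]
      lpos[of s] z_pos[OF a, of s]
    by (simp add: B'_def power2_eq_square algebra_simps)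
  have Z: "((\<lambda>s. - (a * sin (2 * s)) / z_prof a s) has_real_derivative
      - (z_prof a s - (c_const a)\<^sup>2 / z_prof a s ^ 3)) (at s)" for s
    using DERIV_minus[OF sin_over_z_deriv[OF a, of s]] by simp
  have om: "omega a s = c / (z * l\<^sup>2)"
    by (simp add: omega_def defs sqrt_lam_sq[OF a])
  have "d1 (d1 (immersion a)) p \<bullet> normal_field a p
    = (A' s - c / (z * l) * omega a s) * (- c / l)
      + (B' s + a * S / l * omega a s) * (a * S / (z * l)) + - (z - c\<^sup>2 / z ^ 3) * (c / z)"
    unfolding d1_immersion[OF a] d1_in_frame[OF a A B Z] normal_field_def inner_in_frame
    by (simp add: defs s_def)
  also have "A' s = 2 * a * C / l - a\<^sup>2 * S\<^sup>2 / l ^ 3"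
    unfolding A'_def defs[symmetric] using pos
    by (simp add: divide_simps) (simp add: algebra_simps power2_eq_square power3_eq_cube)
  also have "B' s = c * a * S / (z ^ 3 * l) - c * a * S / (z * l ^ 3)"
    unfolding B'_def defs[symmetric] using pos
    by (simp add: divide_simps) (simp add: algebra_simps power2_eq_square power3_eq_cube)
  also have "(2 * a * C / l - a\<^sup>2 * S\<^sup>2 / l ^ 3 - c / (z * l) * omega a s) * (- c / l)
      + (c * a * S / (z ^ 3 * l) - c * a * S / (z * l ^ 3) + a * S / l * omega a s) * (a * S / (z * l))
      + - (z - c\<^sup>2 / z ^ 3) * (c / z)
    = c * (- (2 * a * C) * l\<^sup>2 * z ^ 4 + a\<^sup>2 * S\<^sup>2 * z ^ 4 + c\<^sup>2 * z\<^sup>2 + a\<^sup>2 * S\<^sup>2 * l\<^sup>2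
      - z ^ 4 * l ^ 4 + c\<^sup>2 * l ^ 4) / (z ^ 4 * l ^ 4)"
    unfolding om using pos
    by (simp add: divide_simps) (simp add: algebra_simps power2_eq_square power3_eq_cube power4_eq_xxxx)
  also have "- (2 * a * C) * l\<^sup>2 * z ^ 4 + a\<^sup>2 * S\<^sup>2 * z ^ 4 + c\<^sup>2 * z\<^sup>2 + a\<^sup>2 * S\<^sup>2 * l\<^sup>2
      - z ^ 4 * l ^ 4 + c\<^sup>2 * l ^ 4 = z\<^sup>2 * l ^ 4"
  proof -
    have "l\<^sup>2 * z\<^sup>2 = c\<^sup>2 + a\<^sup>2 * S\<^sup>2" "l\<^sup>2 + z\<^sup>2 = 1" "2 * a * C = z\<^sup>2 - l\<^sup>2"
      unfolding rel by (simp_all add: algebra_simps power2_eq_square)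
    then show ?thesis by algebra
  qed
  also have "c * (z\<^sup>2 * l ^ 4) / (z ^ 4 * l ^ 4) = c / z\<^sup>2"
    using pos by (simp add: field_simps)
  finally show ?thesis by (simp add: defs s_def)
qed

section \<open>Killing fields of the three-sphere\<close>

lemma killing_field_has_derivative:
  assumes "killing_field Z" "p \<in> S3"
  shows "(Z has_derivative frechet_derivative Z (at p)) (at p)"
proof -
  obtain W where "S3 \<subseteq> W" "\<forall>k. Ck_on k W Z"
    using assms(1) by (auto simp: killing_field_def smooth_near_def)
  then have "Ck_on (Suc 0) W Z" by blast
  then have "Z differentiable (at p)" using \<open>S3 \<subseteq> W\<close> assms(2) by auto
  then show ?thesis by (simp add: frechet_derivative_works)
qed

text \<open>The inner product of a Killing field with the velocity of a geodesic is conserved: its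
  derivative vanishes by the equation of Killing, and because the acceleration of a great circle
  is minus its position, to which the field is orthogonal.\<close>

lemma killing_field_along_geodesic:
  assumes Z: "killing_field Z" and unit: "norm p = 1" "norm w = 1" and orth: "p \<bullet> w = 0"
  shows "Z (cos t *\<^sub>R p + sin t *\<^sub>R w) \<bullet> (- sin t *\<^sub>R p + cos t *\<^sub>R w) = Z p \<bullet> w"
proof -
  define \<gamma> where "\<gamma> t = cos t *\<^sub>R p + sin t *\<^sub>R w" for t
  define \<delta> where "\<delta> t = - sin t *\<^sub>R p + cos t *\<^sub>R w" for t
  have pw: "p \<bullet> p = 1" "w \<bullet> w = 1" "w \<bullet> p = 0" using unit orth by (auto simp: norm_eq_1 inner_commute)
  have on_sphere: "\<gamma> t \<in> S3" for t
  proof -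
    have "\<gamma> t \<bullet> \<gamma> t = 1"
      using sin_cos_squared_add[of t]
      by (simp add: \<gamma>_def inner_add_left inner_add_right pw orth power2_eq_square)
    then show ?thesis by (simp add: norm_eq_1)
  qed
  have tangent: "\<delta> t \<bullet> \<gamma> t = 0" for t
    by (simp add: \<gamma>_def \<delta>_def inner_add_left inner_add_right inner_diff_left pw orth)
  have d\<gamma>: "(\<gamma> has_vector_derivative \<delta> t) (at t)" for t
    unfolding \<gamma>_def \<delta>_def by (auto intro!: derivative_eq_intros)
  have d\<delta>: "(\<delta> has_vector_derivative - \<gamma> t) (at t)" for t
    unfolding \<gamma>_def \<delta>_def by (auto intro!: derivative_eq_intros)
  have "((\<lambda>t. Z (\<gamma> t) \<bullet> \<delta> t) has_real_derivative 0) (at t)" for t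
  proof -
    let ?DZ = "frechet_derivative Z (at (\<gamma> t))"
    have "((\<lambda>t. Z (\<gamma> t)) has_vector_derivative ?DZ (\<delta> t)) (at t)"
      using vector_derivative_diff_chain_within[OF d\<gamma>[of t], of Z ?DZ]
        has_derivative_at_withinI[OF killing_field_has_derivative[OF Z on_sphere]]
      by (simp add: o_def)
    from bounded_bilinear.has_vector_derivative[OF bounded_bilinear_inner this d\<delta>[of t]]
    have "((\<lambda>t. Z (\<gamma> t) \<bullet> \<delta> t) has_vector_derivative Z (\<gamma> t) \<bullet> - \<gamma> t + ?DZ (\<delta> t) \<bullet> \<delta> t) (at t)" .
    moreover have "?DZ (\<delta> t) \<bullet> \<delta> t + \<delta> t \<bullet> ?DZ (\<delta> t) = 0" "Z (\<gamma> t) \<bullet> \<gamma> t = 0"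
      using Z on_sphere tangent unfolding killing_field_def by blast+
    ultimately show ?thesis
      by (simp add: has_real_derivative_iff_has_vector_derivative inner_commute)
  qed
  then have "Z (\<gamma> t) \<bullet> \<delta> t = Z (\<gamma> 0) \<bullet> \<delta> 0"
    using DERIV_isconst_all[of "\<lambda>t. Z (\<gamma> t) \<bullet> \<delta> t"] by blast
  then show ?thesis by (simp add: \<gamma>_def \<delta>_def)
qed

text \<open>Any two points lie on a common great circle. Conservation along it relates the component of
  \<open>Z p\<close> in the direction of \<open>q\<close> to that of \<open>Z q\<close> in the direction of \<open>p\<close>.\<close>

lemma killing_field_antisym:
  assumes Z: "killing_field Z" and p: "p \<in> S3" and q: "q \<in> S3"
  shows "Z p \<bullet> q = - (Z q \<bullet> p)"
proof -
  have tan: "Z p \<bullet> p = 0" "Z q \<bullet> q = 0" using Z p q by (auto simp: killing_field_def)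
  have pp: "p \<bullet> p = 1" and qq: "q \<bullet> q = 1" using p q by (auto simp: norm_eq_1)
  define r where "r = q - (p \<bullet> q) *\<^sub>R p"
  have pr: "p \<bullet> r = 0" by (simp add: r_def inner_diff_right pp)
  have rr: "r \<bullet> r = 1 - (p \<bullet> q)\<^sup>2"
    by (simp add: r_def inner_diff_left inner_diff_right pp qq inner_commute power2_eq_square)
  show ?thesis
  proof (cases "r = 0")
    case True
    then have q_eq: "q = (p \<bullet> q) *\<^sub>R p" by (simp add: r_def)
    have "(p \<bullet> q)\<^sup>2 = 1" using rr True by simp
    then have "(p \<bullet> q) *\<^sub>R q = p"
      by (subst q_eq) (simp add: power2_eq_square inner_commute)
    then have "Z q \<bullet> p = 0" using tan(2) by (metis inner_scaleR_right mult_zero_right)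
    moreover have "Z p \<bullet> q = 0" using tan(1) q_eq by (metis inner_scaleR_right mult_zero_right)
    ultimately show ?thesis by simp
  next
    case False
    define w where "w = (1 / norm r) *\<^sub>R r"
    have "(p \<bullet> q)\<^sup>2 + (norm r)\<^sup>2 = 1" using rr by (simp add: power2_norm_eq_inner)
    then obtain t where t: "p \<bullet> q = cos t" "norm r = sin t" using sincos_total_2pi by metis
    have w: "norm w = 1" "p \<bullet> w = 0" using False pr by (simp_all add: w_def)
    have q_eq: "q = cos t *\<^sub>R p + sin t *\<^sub>R w"
      using False by (simp add: w_def r_def flip: t)
    have p_eq: "p = cos t *\<^sub>R q - sin t *\<^sub>R (- sin t *\<^sub>R p + cos t *\<^sub>R w)"
    proof -
      have "(cos t * cos t) *\<^sub>R p + (sin t * sin t) *\<^sub>R p = p"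
        by (simp flip: scaleR_left_distrib)
      then show ?thesis unfolding q_eq by (simp add: algebra_simps)
    qed
    have "Z p \<bullet> q = sin t * (Z p \<bullet> w)"
      by (subst q_eq) (simp add: inner_add_right tan)
    moreover have "Z q \<bullet> (- sin t *\<^sub>R p + cos t *\<^sub>R w) = Z p \<bullet> w"
      using killing_field_along_geodesic[OF Z _ w, of t] p q_eq by simp
    then have "Z q \<bullet> p = - sin t * (Z p \<bullet> w)"
      by (subst p_eq) (simp only: inner_diff_right inner_scaleR_right tan)
    ultimately show ?thesis by simp
  qed
qed

lemma axis_on_S3: "axis i (1::real) \<in> (S3 :: (real^4) set)"
  by simp

text \<open>Antisymmetry against the standard basis shows that \<open>Z\<close> is the restriction of a linear map, with
  matrix entries given by its values at the basis vectors.\<close>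

lemma killing_field_expansion:
  assumes Z: "killing_field Z" and p: "p \<in> S3"
  shows "Z p \<bullet> v = - (\<Sum>i\<in>UNIV. v $ i * (Z (axis i 1) \<bullet> p))"
proof -
  have "Z p \<bullet> v = (\<Sum>i\<in>UNIV. Z p $ i * v $ i)" by (simp add: inner_vec_def)
  also have "\<dots> = (\<Sum>i\<in>UNIV. - (v $ i * (Z (axis i 1) \<bullet> p)))"
  proof (rule sum.cong[OF refl])
    fix i
    have "Z p $ i = Z p \<bullet> axis i 1" by (rule cart_eq_inner_axis)
    also have "\<dots> = - (Z (axis i 1) \<bullet> p)" by (rule killing_field_antisym[OF Z p axis_on_S3])
    finally show "Z p $ i * v $ i = - (v $ i * (Z (axis i 1) \<bullet> p))" by simp
  qed
  finally show ?thesis by (simp add: sum_negf)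
qed

lemma base_point_axis: "base_point = axis 1 1"
  by (simp add: base_point_def vec_eq_iff forall_4 axis_def)

text \<open>A point of the boundary sphere stays in the ball under the flow, so its height over the
  centre is minimal at time \<open>0\<close> and \<open>Z\<close> is orthogonal to the centre there. By antisymmetry
  \<open>Z base_point\<close> is orthogonal to the boundary sphere, which contains points in every tangential
  direction from the centre.\<close>

lemma killing_field_preserving_ball_fixes_center:
  assumes Z: "killing_field Z" and x: "\<bar>x\<bar> < 1"
    and flow: "flow_preserves Z (geodesic_ball (arccos x))"
  shows "Z base_point = 0"
proof -
  have base: "base_point \<in> S3" "base_point \<bullet> base_point = 1"
    by (simp_all add: base_point_axis)
  obtain \<Phi> where \<Phi>: "is_flow Z \<Phi>" and pres: "\<And>t. \<Phi> t ` geodesic_ball (arccos x) = geodesic_ball (arccos x)"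
    using flow by (auto simp: flow_preserves_def)
  have ball: "q \<in> geodesic_ball (arccos x) \<longleftrightarrow> q \<in> S3 \<and> x \<le> base_point \<bullet> q" for q
  proof (cases "q \<in> S3")
    case True
    have "\<bar>base_point \<bullet> q\<bar> \<le> norm base_point * norm q" by (rule Cauchy_Schwarz_ineq2)
    then have "\<bar>base_point \<bullet> q\<bar> \<le> 1" using True base(1) by simp
    then show ?thesis using True x by (simp add: geodesic_ball_def arccos_le_mono)
  qed (simp add: geodesic_ball_def)
  have boundary: "Z base_point \<bullet> q = 0" if q: "q \<in> S3" "base_point \<bullet> q = x" for q
  proof -
    have "q \<in> geodesic_ball (arccos x)" using q by (simp add: ball)
    then have inside: "x \<le> base_point \<bullet> \<Phi> t q" for t
      using pres[of t] ball by blast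
    have "\<Phi> 0 q = q \<and> (\<forall>t. \<Phi> t q \<in> S3 \<and> ((\<lambda>\<tau>. \<Phi> \<tau> q) has_vector_derivative Z (\<Phi> t q)) (at t))"
      using \<Phi> q(1) unfolding is_flow_def by blast
    then have start: "\<Phi> 0 q = q" and "((\<lambda>\<tau>. \<Phi> \<tau> q) has_vector_derivative Z (\<Phi> 0 q)) (at 0)"
      by blast+
    then have "((\<lambda>\<tau>. \<Phi> \<tau> q) has_derivative (\<lambda>h. h *\<^sub>R Z q)) (at 0)"
      by (simp add: has_vector_derivative_def)
    from has_derivative_inner_right[OF this, of base_point]
    have "((\<lambda>\<tau>. base_point \<bullet> \<Phi> \<tau> q) has_real_derivative base_point \<bullet> Z q) (at 0)"
      by (simp add: has_field_derivative_def mult_commute_abs)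
    then have "base_point \<bullet> Z q = 0"
      by (rule DERIV_local_min[OF _ zero_less_one]) (use inside q start in auto)
    then show ?thesis
      using killing_field_antisym[OF Z base(1) q(1)] by (simp add: inner_commute)
  qed
  have tan: "Z base_point \<bullet> base_point = 0" using Z base(1) by (auto simp: killing_field_def)
  show ?thesis
  proof (rule ccontr)
    assume nz: "Z base_point \<noteq> 0"
    define w where "w = (1 / norm (Z base_point)) *\<^sub>R Z base_point"
    define q where "q = x *\<^sub>R base_point + sqrt (1 - x\<^sup>2) *\<^sub>R w"
    have x2: "x\<^sup>2 < 1" using x by (simp add: abs_square_less_1)
    have w: "w \<bullet> w = 1" "base_point \<bullet> w = 0"
      using nz tan by (simp_all add: w_def inner_commute power2_norm_eq_inner[symmetric] power2_eq_square)
    have "q \<bullet> q = 1"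
      using x2 w base(2) by (simp add: q_def inner_add_left inner_add_right inner_commute flip: power2_eq_square)
    then have "q \<in> S3" by (simp add: norm_eq_1)
    moreover have "base_point \<bullet> q = x" using w base(2) by (simp add: q_def inner_add_right)
    ultimately have "Z base_point \<bullet> q = 0" by (rule boundary)
    then have "sqrt (1 - x\<^sup>2) * (Z base_point \<bullet> w) = 0" by (simp add: q_def inner_add_right tan)
    then have "Z base_point \<bullet> w = 0" using x2 by simp
    then show False using nz by (simp add: w_def)
  qed
qed

text \<open>A skew linear map that kills the first basis vector couples only the last three coordinates.
  The two points and the two vectors differ by a half turn in the last two coordinates, and the
  only entry that survives, the one between the second and third basis vectors, contributes with
  opposite signs.\<close>

lemma killing_field_fixing_center_odd:
  assumes Z: "killing_field Z" and fix_center: "Z base_point = 0"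
    and "vector [x, y, z, 0] \<in> S3"
  shows "Z (vector [x, y, z, 0]) \<bullet> vector [n1, n2, n3, 0]
    + Z (vector [x, y, - z, 0]) \<bullet> vector [n1, n2, - n3, 0] = 0"
proof -
  let ?e = "\<lambda>i. axis i 1 :: real^4"
  have anti: "Z (?e i) \<bullet> ?e j = - (Z (?e j) \<bullet> ?e i)" for i j
    by (intro killing_field_antisym[OF Z] axis_on_S3)
  have e1: "Z (?e 1) = 0" using fix_center by (simp add: base_point_axis)
  have S3': "vector [x, y, - z, 0] \<in> S3"
    using assms(3) by (simp add: norm_eq_1)
  have inner: "u \<bullet> vector [x, y, c, 0] = x * (u \<bullet> ?e 1) + y * (u \<bullet> ?e 2) + c * (u \<bullet> ?e 3)" for c and u :: "real^4"
    unfolding vector4_axis by (simp add: inner_add_right)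
  show ?thesis
    unfolding killing_field_expansion[OF Z assms(3)] killing_field_expansion[OF Z S3'] sum_4 inner e1
    using anti[of 2 1] anti[of 2 2] anti[of 3 1] anti[of 3 3] anti[of 3 2] e1
    by (simp add: algebra_simps)
qed

section \<open>The variation field of the family as a Jacobi function\<close>

text \<open>A ring of functions that is closed under differentiation and contains the Jacobi function
  below; membership therefore gives smoothness of every order.\<close>

inductive profile_ring :: "real \<Rightarrow> (real \<Rightarrow> real) \<Rightarrow> bool" for a where
  "profile_ring a (\<lambda>_. k)"
| "profile_ring a (\<lambda>s. cos (2 * s))"
| "profile_ring a (\<lambda>s. sin (2 * s))"
| "profile_ring a (\<lambda>s. 1 / z_prof a s)"
| "profile_ring a (area_rate a)"
| "profile_ring a f \<Longrightarrow> profile_ring a g \<Longrightarrow> profile_ring a (\<lambda>s. f s + g s)"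
| "profile_ring a f \<Longrightarrow> profile_ring a g \<Longrightarrow> profile_ring a (\<lambda>s. f s * g s)"

lemma profile_ring_deriv:
  assumes a: "a \<in> params" and "profile_ring a f"
  shows "\<exists>f'. profile_ring a f' \<and> (\<forall>s. (f has_real_derivative f' s) (at s))"
  using assms(2)
proof induction
  case (1 k)
  show ?case by (intro exI[of _ "\<lambda>_. 0"]) (auto intro: profile_ring.intros)
next
  case 2
  have "profile_ring a (\<lambda>s. - 2 * sin (2 * s))" by (intro profile_ring.intros)
  then show ?case by (intro exI conjI) (auto intro!: derivative_eq_intros)
next
  case 3
  have "profile_ring a (\<lambda>s. 2 * cos (2 * s))" by (intro profile_ring.intros)
  then show ?case by (intro exI conjI) (auto intro!: derivative_eq_intros)
next
  case 4
  have "profile_ring a (\<lambda>s. a * (sin (2 * s) * (1 / z_prof a s * (1 / z_prof a s * (1 / z_prof a s)))))"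
    by (intro profile_ring.intros)
  moreover have "((\<lambda>s. 1 / z_prof a s) has_real_derivative
      a * (sin (2 * s) * (1 / z_prof a s * (1 / z_prof a s * (1 / z_prof a s))))) (at s)" for s
    using DERIV_divide[OF DERIV_const[of 1] z_deriv[OF a, of s]] z_pos[OF a, of s] by simp
  ultimately show ?case by blast
next
  case 5
  have "profile_ring a (\<lambda>s. 1/2 * (cos (2 * s) * (1 / z_prof a s)))" by (intro profile_ring.intros)
  moreover have "(area_rate a has_real_derivative 1/2 * (cos (2 * s) * (1 / z_prof a s))) (at s)" for s
    using area_rate_deriv[OF a, of s] by simp
  ultimately show ?case by blast
next
  case (6 f g)
  then obtain f' g' where "profile_ring a f'" "\<forall>s. (f has_real_derivative f' s) (at s)"
    "profile_ring a g'" "\<forall>s. (g has_real_derivative g' s) (at s)" by blast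
  then show ?case
    by (intro exI[of _ "\<lambda>s. f' s + g' s"]) (auto intro!: profile_ring.intros DERIV_add)
next
  case (7 f g)
  then obtain f' g' where *: "profile_ring a f'" "\<forall>s. (f has_real_derivative f' s) (at s)"
    "profile_ring a g'" "\<forall>s. (g has_real_derivative g' s) (at s)" by blast
  have "profile_ring a (\<lambda>s. f' s * g s + g' s * f s)"
    using * 7 by (intro profile_ring.intros)
  moreover have "((\<lambda>s. f s * g s) has_real_derivative f' s * g s + g' s * f s) (at s)" for s
    using * by (intro DERIV_mult) auto
  ultimately show ?case by blast
qed

lemma profile_ring_smooth:
  assumes a: "a \<in> params"
  shows "profile_ring a f \<Longrightarrow> Ck_on k UNIV (\<lambda>p :: real \<times> real. f (fst p))"
proof (induction k arbitrary: f)
  case 0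
  obtain f' where "\<And>s. (f has_real_derivative f' s) (at s)"
    using profile_ring_deriv[OF a 0] by blast
  then have "continuous_on UNIV f"
    by (intro DERIV_continuous_on) (auto intro: has_field_derivative_at_within)
  then show ?case
    by (auto intro!: continuous_on_compose2[of UNIV f] continuous_intros)
next
  case (Suc k)
  obtain f' where f': "profile_ring a f'" "\<And>s. (f has_real_derivative f' s) (at s)"
    using profile_ring_deriv[OF a Suc.prems] by blast
  have der: "((\<lambda>p :: real \<times> real. f (fst p)) has_derivative (\<lambda>v. f' (fst p) * fst v)) (at p)" for p
    using has_derivative_compose[OF has_derivative_fst[OF has_derivative_ident], of f "(*) (f' (fst p))" p UNIV]
      f'(2)[of "fst p"] by (simp add: has_field_derivative_def)
  have "frechet_derivative (\<lambda>p. f (fst p)) (at p) v = f' (fst p) * fst v" for p v :: "real \<times> real"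
    using frechet_derivative_at[OF der[of p]] by metis
  moreover have "Ck_on k UNIV (\<lambda>p :: real \<times> real. f' (fst p) * c)" for c
    by (rule Suc.IH) (intro profile_ring.intros f')
  moreover have "(\<lambda>p. f (fst p)) differentiable (at p)" for p :: "real \<times> real"
    using der[of p] unfolding differentiable_def by blast
  ultimately show ?case by simp
qed

text \<open>This is \<open>c\<close> times the normal component of \<open>\<partial>\<^sub>a X\<^sub>a\<close>, namely \<open>C/2 - z' K\<close> with \<open>z' = - a S/z\<close>:
  the elementary terms that come from \<open>\<partial>\<^sub>a \<beta>\<close> and from \<open>\<partial>\<^sub>a \<lambda>\<close> combine to \<open>C/2\<close> because
  \<open>c\<^sup>2 + a\<^sup>2 S\<^sup>2 = \<lambda> z\<^sup>2\<close>.\<close>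

definition jacobi_fun :: "real \<Rightarrow> real \<Rightarrow> real" where
  "jacobi_fun a s = cos (2 * s) / 2 + a * sin (2 * s) / z_prof a s * area_rate a s"

definition jacobi_slope :: "real \<Rightarrow> real \<Rightarrow> real" where
  "jacobi_slope a s = - sin (2 * s) + (z_prof a s - (c_const a)\<^sup>2 / z_prof a s ^ 3) * area_rate a s
     + a * sin (2 * s) * cos (2 * s) / (2 * (z_prof a s)\<^sup>2)"

lemma jacobi_fun_deriv:
  assumes a: "a \<in> params"
  shows "(jacobi_fun a has_real_derivative jacobi_slope a s) (at s)"
proof -
  have "((\<lambda>s. cos (2 * s) / 2) has_real_derivative - sin (2 * s)) (at s)"
    by (auto intro!: derivative_eq_intros)
  from DERIV_add[OF this DERIV_mult[OF sin_over_z_deriv[OF a, of s] area_rate_deriv[OF a, of s]]]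
  show ?thesis
    unfolding jacobi_fun_def jacobi_slope_def
    by (rule DERIV_cong) (use z_pos[OF a, of s] in \<open>simp add: power2_eq_square ac_simps\<close>)
qed

text \<open>The Jacobi equation \<open>(z u')'/z + (|A|\<^sup>2 + 2) u = 0\<close> for functions of \<open>s\<close> alone, where
  \<open>|A|\<^sup>2 = 2c\<^sup>2/z\<^sup>4\<close>.\<close>

lemma jacobi_flux_deriv:
  assumes a: "a \<in> params"
  shows "((\<lambda>s. z_prof a s * jacobi_slope a s) has_real_derivative
    - (2 * (c_const a)\<^sup>2 / z_prof a s ^ 4 + 2) * z_prof a s * jacobi_fun a s) (at s)"
proof -
  define z c C S K where defs: "z = z_prof a s" "c = c_const a" "C = cos (2 * s)" "S = sin (2 * s)"
    "K = area_rate a s"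
  have pos: "z > 0" "c > 0" using z_pos[OF a] c_pos[OF a] by (auto simp: defs)
  have rel: "z\<^sup>2 = 1/2 + a * C" "c\<^sup>2 = 1/4 - a\<^sup>2" "S\<^sup>2 = 1 - C\<^sup>2"
    using a unfolding defs(1-4) by (simp_all add: z_sq c_sq sin_squared_eq)
  have flux: "(\<lambda>s. z_prof a s * jacobi_slope a s) = (\<lambda>s. - (z_prof a s * sin (2 * s))
      + ((z_prof a s)\<^sup>2 - (c_const a)\<^sup>2 / (z_prof a s)\<^sup>2) * area_rate a s
      + a * sin (2 * s) / z_prof a s * (cos (2 * s) / 2))"
  proof
    fix s
    show "z_prof a s * jacobi_slope a s = - (z_prof a s * sin (2 * s))
      + ((z_prof a s)\<^sup>2 - (c_const a)\<^sup>2 / (z_prof a s)\<^sup>2) * area_rate a s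
      + a * sin (2 * s) / z_prof a s * (cos (2 * s) / 2)"
      using z_pos[OF a, of s]
      by (simp add: jacobi_slope_def divide_simps) (simp add: algebra_simps eval_nat_numeral)
  qed
  have z': "(z_prof a has_real_derivative - (a * S) / z) (at s)"
    using z_deriv[OF a, of s] by (simp add: defs)
  have t1: "((\<lambda>s. z_prof a s * sin (2 * s)) has_real_derivative - (a * S) / z * S + 2 * C * z) (at s)"
    by (rule DERIV_cong[OF DERIV_mult[OF z', of "\<lambda>s. sin (2 * s)" "2 * C"]])
       (auto intro!: derivative_eq_intros simp: defs)
  have sq: "((\<lambda>s. (z_prof a s)\<^sup>2) has_real_derivative - 2 * (a * S)) (at s)"
    using DERIV_power[OF z', of 2] pos by (simp add: defs)
  have t2: "((\<lambda>s. (z_prof a s)\<^sup>2 - (c_const a)\<^sup>2 / (z_prof a s)\<^sup>2) has_real_derivative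
      - 2 * (a * S) - 2 * (a * S) * c\<^sup>2 / z ^ 4) (at s)"
    by (rule DERIV_cong[OF DERIV_diff[OF sq DERIV_divide[OF DERIV_const sq]]])
       (use pos in \<open>simp_all add: defs power2_eq_square power4_eq_xxxx ac_simps\<close>)
  have t3: "((\<lambda>s. cos (2 * s) / 2) has_real_derivative - S) (at s)"
    by (auto intro!: derivative_eq_intros simp: defs)
  have "((\<lambda>s. z_prof a s * jacobi_slope a s) has_real_derivative
      - (- (a * S) / z * S + 2 * C * z)
      + ((- 2 * (a * S) - 2 * (a * S) * c\<^sup>2 / z ^ 4) * K + C / (2 * z) * (z\<^sup>2 - c\<^sup>2 / z\<^sup>2))
      + ((z - c\<^sup>2 / z ^ 3) * (C / 2) + - S * (a * S / z))) (at s)"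
    unfolding flux defs
    by (intro DERIV_add DERIV_minus DERIV_mult t1[unfolded defs] t2[unfolded defs] t3[unfolded defs]
        sin_over_z_deriv[OF a] area_rate_deriv[OF a])
  also have "- (- (a * S) / z * S + 2 * C * z)
      + ((- 2 * (a * S) - 2 * (a * S) * c\<^sup>2 / z ^ 4) * K + C / (2 * z) * (z\<^sup>2 - c\<^sup>2 / z\<^sup>2))
      + ((z - c\<^sup>2 / z ^ 3) * (C / 2) + - S * (a * S / z))
    = - (2 * c\<^sup>2 / z ^ 4 + 2) * z * (C / 2 + a * S / z * K)"
    using pos by (simp add: divide_simps) (simp add: algebra_simps eval_nat_numeral)
  finally show ?thesis by (simp add: jacobi_fun_def defs)
qed

lemma jacobi_slope_odd:
  "a \<in> params \<Longrightarrow> jacobi_slope a (- s) = - jacobi_slope a s"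
  by (simp add: jacobi_slope_def area_rate_odd)

lemma jacobi_fun_even:
  "a \<in> params \<Longrightarrow> jacobi_fun a (- s) = jacobi_fun a s"
  by (simp add: jacobi_fun_def area_rate_odd)

text \<open>The coefficient of \<open>u\<close> on the left is \<open>- cot R\<close> when \<open>s = s\<^sub>1(a)\<close>, so the left-hand side is
  the Robin operator applied to the variation field. It vanishes with the first variation of the
  radius because the members of the family then stay in the same ball to first order.\<close>

lemma jacobi_robin_defect:
  assumes a: "a \<in> params"
  shows "jacobi_slope a s + a * sin (2 * s) / (z_prof a s)\<^sup>2 * jacobi_fun a s
    = - balance a s / z_prof a s ^ 3"
proof -
  define z c C S K where defs: "z = z_prof a s" "c = c_const a" "C = cos (2 * s)" "S = sin (2 * s)"
    "K = area_rate a s"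
  have pos: "z > 0" using z_pos[OF a] by (auto simp: defs)
  have rel: "z\<^sup>2 = 1/2 + a * C" "c\<^sup>2 = 1/4 - a\<^sup>2" "S\<^sup>2 = 1 - C\<^sup>2"
    using a unfolding defs(1-4) by (simp_all add: z_sq c_sq sin_squared_eq)
  have "jacobi_slope a s + a * sin (2 * s) / (z_prof a s)\<^sup>2 * jacobi_fun a s
     = (- S * z * (z\<^sup>2 - a * C) + ((z\<^sup>2)\<^sup>2 - c\<^sup>2 + a\<^sup>2 * S\<^sup>2) * K) / z ^ 3"
    unfolding jacobi_slope_def jacobi_fun_def defs[symmetric]
    using pos by (simp add: divide_simps) (simp add: algebra_simps eval_nat_numeral)
  also have "z\<^sup>2 - a * C = 1/2" by (simp add: rel)
  also have "(z\<^sup>2)\<^sup>2 - c\<^sup>2 + a\<^sup>2 * S\<^sup>2 = a * (2 * a + C)"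
    unfolding rel by (simp add: algebra_simps power2_eq_square)
  finally show ?thesis by (simp add: balance_def defs)
qed

lemma cot_radius:
  assumes a: "a \<in> params"
  shows "cot (radius a) = - (a * sin (2 * s1 a) / (z_prof a (s1 a))\<^sup>2)"
  unfolding radius_eq[OF a]
  using tan_arctan[of "a * sin (2 * s1 a) / (z_prof a (s1 a))\<^sup>2"] unfolding tan_def
  by (simp add: cot_def sin_add cos_add)

lemma jacobi_fun_in_kernel:
  assumes a: "a \<in> params" and crit: "balance a (s1 a) = 0"
  shows "(\<lambda>p. jacobi_fun a (fst p)) \<in> jacobi_robin_kernel a (normal_field a)"
proof -
  let ?u = "\<lambda>p :: real \<times> real. jacobi_fun a (fst p)"
  have "profile_ring a (\<lambda>s. 1/2 * cos (2 * s) + a * (sin (2 * s) * (1 / z_prof a s * area_rate a s)))"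
    by (intro profile_ring.intros)
  also have "(\<lambda>s. 1/2 * cos (2 * s) + a * (sin (2 * s) * (1 / z_prof a s * area_rate a s))) = jacobi_fun a"
    by (simp add: jacobi_fun_def fun_eq_iff)
  finally have smooth: "smooth_near (strip a) ?u"
    using profile_ring_smooth[OF a] unfolding smooth_near_def by (intro exI[of _ UNIV]) auto
  have d1u: "d1 ?u p = jacobi_slope a (fst p)" for p
    unfolding d1_def
    using jacobi_fun_deriv[OF a, of "fst p"]
    by (simp add: has_real_derivative_iff_has_vector_derivative vector_derivative_at)
  have d2_0: "d2 (\<lambda>p. g (fst p)) p = 0" for g :: "real \<Rightarrow> real" and p
    by (simp add: d2_def)
  have flux1: "(g22 (immersion a) q * d1 ?u q - g12 (immersion a) q * d2 ?u q) / sqrt (gdet (immersion a) q)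
      = z_prof a (fst q) * jacobi_slope a (fst q)" for q
    unfolding sqrt_gdet_immersion[OF a] g12_immersion[OF a] g22_immersion d1u
    using z_pos[OF a, of "fst q"] by (simp add: power2_eq_square)
  have flux2: "(g11 (immersion a) q * d2 ?u q - g12 (immersion a) q * d1 ?u q) / sqrt (gdet (immersion a) q)
      = 0" for q
    by (simp add: g12_immersion[OF a] d2_0)
  have laplace: "laplace_beltrami (immersion a) ?u p
      = - (2 * (c_const a)\<^sup>2 / z_prof a (fst p) ^ 4 + 2) * ?u p" for p
  proof -
    have "d1 (\<lambda>q. z_prof a (fst q) * jacobi_slope a (fst q)) p
        = - (2 * (c_const a)\<^sup>2 / z_prof a (fst p) ^ 4 + 2) * z_prof a (fst p) * ?u p"
      unfolding d1_def using jacobi_flux_deriv[OF a, of "fst p"]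
      by (simp add: has_real_derivative_iff_has_vector_derivative vector_derivative_at)
    then show ?thesis
      unfolding laplace_beltrami_def flux1 flux2
      unfolding sqrt_gdet_immersion[OF a]
      using z_pos[OF a, of "fst p"] by (simp add: d2_def)
  qed
  have normA: "sq_norm_A (immersion a) (normal_field a) p = 2 * (c_const a)\<^sup>2 / z_prof a (fst p) ^ 4" for p
  proof -
    have h12: "d1 (d2 (immersion a)) p \<bullet> normal_field a p = 0"
      unfolding d2_immersion d1_angular[OF z_deriv[OF a]]
      by (simp add: normal_field_def inner_commute[of "angular _ _"] inner_in_frame_angular)
    \<comment> \<open>Here \<open>h\<^sub>2\<^sub>2 = - c\<close>, hence the principal curvature \<open>h\<^sub>2\<^sub>2/z\<^sup>2 = - c/z\<^sup>2\<close>.\<close>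
    have h22: "d2 (d2 (immersion a)) p \<bullet> normal_field a p = - c_const a"
      unfolding d2_immersion d2_angular normal_field_def in_frame_def inner_revolve
      using z_pos[OF a, of "fst p"] by simp
    show ?thesis
      unfolding sq_norm_A_def Let_def h12 h22 d1_d1_immersion_normal[OF a]
        g11_immersion[OF a] g12_immersion[OF a] g22_immersion gdet_immersion[OF a]
      using z_pos[OF a, of "fst p"]
      by (simp add: divide_simps power2_eq_square power4_eq_xxxx)
  qed
  have conormal: "conormal_derivative (immersion a) ?u p = jacobi_slope a (fst p)" for p
  proof -
    have "sqrt (g22 (immersion a) p * gdet (immersion a) p) = (z_prof a (fst p))\<^sup>2"
      unfolding g22_immersion gdet_immersion[OF a] real_sqrt_abs2 by simp
    then show ?thesis
      unfolding conormal_derivative_def g12_immersion[OF a] g22_immersion d1u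
      using z_pos[OF a, of "fst p"] by simp
  qed
  have robin: "jacobi_slope a (s1 a) - cot (radius a) * jacobi_fun a (s1 a) = 0"
    using jacobi_robin_defect[OF a, of "s1 a"] crit by (simp add: cot_radius[OF a])
  show ?thesis
    unfolding jacobi_robin_kernel_def
    using smooth robin
    by (auto simp: periodic_on_strip_def laplace normA conormal jacobi_slope_odd[OF a] jacobi_fun_even[OF a]
        algebra_simps)
qed

lemma x_prof_less_1:
  assumes a: "a \<in> params"
  shows "\<bar>x_prof a s\<bar> < 1"
proof -
  have "(x_prof a s)\<^sup>2 = lam_prof a s * (cos (beta a s))\<^sup>2"
    by (simp add: x_prof_def power_mult_distrib sqrt_lam_sq[OF a])
  also have "\<dots> \<le> lam_prof a s * 1"
    using lam_pos[OF a, of s] by (intro mult_left_mono) (auto simp: abs_square_le_1)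
  also have "\<dots> < 1"
  proof -
    have "0 < (z_prof a s)\<^sup>2" using z_pos[OF a, of s] by simp
    then show ?thesis using lam_plus_z_sq[OF a, of s] by linarith
  qed
  finally show ?thesis by (simp add: abs_square_less_1)
qed

text \<open>The Jacobi function takes the value \<open>1/2\<close> at the points \<open>(0, 0)\<close> and \<open>(0, \<pi>)\<close>, whereas a
  Killing field that preserves the ball induces opposite values there.\<close>

lemma critical_imp_degenerate:
  assumes a: "a \<in> params" and crit: "balance a (s1 a) = 0"
  shows "degenerate a"
proof -
  let ?u = "\<lambda>p :: real \<times> real. jacobi_fun a (fst p)"
  have False
    if Z: "killing_field Z" and flow: "flow_preserves Z (geodesic_ball (radius a))"
      and ind: "induced_by a (normal_field a) ?u Z" for Z
  proof -
    have center: "Z base_point = 0"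
      using killing_field_preserving_ball_fixes_center[OF Z x_prof_less_1[OF a]] flow
      by (simp add: radius_def)
    obtain x y z n1 n2 n3 where X: "immersion a (0, 0) = vector [x, y, z, 0]"
      "immersion a (0, pi) = vector [x, y, - z, 0]"
      and N: "normal_field a (0, 0) = vector [n1, n2, n3, 0]"
      "normal_field a (0, pi) = vector [n1, n2, - n3, 0]"
      by (simp add: immersion_def normal_field_def in_frame_def revolve_def)
    have "immersion a (0, 0) \<bullet> immersion a (0, 0) = 1"
      using sqrt_lam_sq[OF a, of 0] lam_plus_z_sq[OF a, of 0]
      by (simp add: immersion_in_frame inner_in_frame power2_eq_square)
    then have "vector [x, y, z, 0] \<in> S3" by (simp add: X norm_eq_1)
    from killing_field_fixing_center_odd[OF Z center this, of n1 n2 n3]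
    have "Z (immersion a (0, 0)) \<bullet> normal_field a (0, 0) + Z (immersion a (0, pi)) \<bullet> normal_field a (0, pi) = 0"
      by (simp only: X N)
    moreover have "(0, 0) \<in> strip a" "(0, pi) \<in> strip a"
      using s1_characterization(1)[OF a] by (auto simp: strip_def)
    ultimately have "?u (0, 0) + ?u (0, pi) = 0"
      using ind unfolding induced_by_def by metis
    then show False by (simp add: jacobi_fun_def)
  qed
  then show ?thesis
    unfolding degenerate_def
    using annulus_normal_field[OF a] jacobi_fun_in_kernel[OF a crit] by blast
qed

section \<open>Critical points of area and radius\<close>

theorem corollary5p15:
  shows "(\<forall>a\<in>{0<..<1/2}. critical_point area a \<longleftrightarrow> critical_point radius a) \<and>
         (\<forall>a\<in>{0<..<1/2}. critical_point radius a \<longrightarrow> degenerate a) \<and>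
         (\<forall>a\<in>{0<..<1/2}. (\<forall>b\<in>{0<..<1/2}. radius b \<le> radius a) \<longrightarrow> strict_local_max area a)"
proof (intro conjI ballI impI)
  fix a assume a: "a \<in> params"
  show "critical_point area a \<longleftrightarrow> critical_point radius a"
    by (simp only: critical_iff_balance[OF a])
  show "degenerate a" if "critical_point radius a"
    using critical_imp_degenerate[OF a] that by (simp only: critical_iff_balance[OF a])
  show "strict_local_max area a" if "\<forall>b\<in>params. radius b \<le> radius a"
    using strict_local_max_area[OF a radius_max_imp_balance[OF a]] that by blast
qed

end
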